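(* Let $r\ge 1$, $m_0\ge m_1\ge\cdots\ge m_r\ge 1$, $A_0=\sigma\sigma^*$ a real symmetric positive semidefinite $m_0\times m_0$ matrix, and $B_k$ a real $m_{k-1}\times m_k$ matrix of rank $m_k$ for $k=1,\dots,r$. Let $(P_t)_{t\ge0}$ be the semigroup on $\mathbb{R}^{m_0}\times\cdots\times\mathbb{R}^{m_r}$ of the diffusion $dX_1(t)=\sigma\,dB(t)$, $dX_{k+1}(t)=B_k^*X_k(t)\,dt$ $(1\le k\le r)$. Let $f\in C^2(\mathbb{R}^{m_0}\times\cdots\times\mathbb{R}^{m_r})$ have bounded second derivatives. Then for every $t\ge 0$, every $x=(x^{(1)},\dots,x^{(r+1)})\in\mathbb{R}^{m_0}\times\cdots\times\mathbb{R}^{m_r}$ and all constants $\alpha_k\in\mathbb{R}$ $(2\le k\le r+1)$, with $\alpha_1=1$, $$\left\|\sum_{i'=1}^{r+1}\alpha_{i'}\prod_{j=1}^{i'-1}B_j\,\nabla^{(i')}P_tf(x)\right\|_{A_0}^2\le P_t\left(\left\|\sum_{i'=1}^{r+1}\left(\sum_{i=0}^{i'-1}\alpha_{i'-i}\frac{t^i}{i!}\prod_{j=1}^{i'-1}B_j\right)\nabla^{(i')}f\right\|_{A_0}^2\right)(x).$$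
   Context: $M^*$ denotes the transpose of a matrix $M$. $\sigma$ is a constant $m_0\times m_0$ matrix with $\sigma\sigma^*=A_0$, $B(t)$ is a standard Brownian motion in $\mathbb{R}^{m_0}$, and $X_{i}(t)$ is $\mathbb{R}^{m_{i-1}}$-valued for $1\le i\le r+1$. For $\mathbf{X}_t=(X_1(t),\dots,X_{r+1}(t))$, $P_tf(x)=\mathbb{E}^x[f(\mathbf{X}_t)]$, where $\mathbf{X}_0=x$. Points are written $x=(x^{(1)},\dots,x^{(r+1)})$ with $x^{(i)}\in\mathbb{R}^{m_{i-1}}$, and $\nabla^{(i)}f$ is the (column) vector of partial derivatives of $f$ with respect to the coordinates of $x^{(i)}$. Ordered products: $\prod_{j=1}^{k}B_j=B_1B_2\cdots B_k$, with the empty product ($k=0$) being the identity. For $v\in\mathbb{R}^{m_0}$, $\|v\|_{A_0}=\sqrt{v^*A_0v}$. *)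

theory Defs
  imports "HOL-Probability.Probability" "Jordan_Normal_Form.DL_Rank"
begin

hide_type (open) Finite_Cartesian_Product.vec
hide_const (open) Finite_Cartesian_Product.vec Determinants.det
no_notation Finite_Cartesian_Product.vec_nth (infixl "$" 90)

text \<open>
  The dimensions are a function \<open>m\<close> with \<open>m 0, \<dots>, m r\<close>. A point of
  \<open>\<real>^(m 0) \<times> \<dots> \<times> \<real>^(m r)\<close> is a doubly indexed family \<open>x\<close>: the block \<open>x k\<close> for
  \<open>k = 1, \<dots>, r + 1\<close> has the \<open>m (k - 1)\<close> coordinates \<open>x k j\<close>, \<open>j < m (k - 1)\<close>. Since
  \<open>x\<close> is extensional, the product topology of the function type induces the
  Euclidean topology on the state space, and the product \<open>\<sigma>\<close>-algebra is the Borel one.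
\<close>

type_synonym point = "nat \<Rightarrow> nat \<Rightarrow> real"

definition state_borel :: "nat \<Rightarrow> (nat \<Rightarrow> nat) \<Rightarrow> point measure" where
  "state_borel r m = PiM {1..r + 1} (\<lambda>k. PiM {..<m (k - 1)} (\<lambda>_. borel))"

definition state_space :: "nat \<Rightarrow> (nat \<Rightarrow> nat) \<Rightarrow> point set" where
  "state_space r m = (\<Pi>\<^sub>E k\<in>{1..r + 1}. \<Pi>\<^sub>E j\<in>{..<m (k - 1)}. UNIV)"

lemma space_state_borel: "space (state_borel r m) = state_space r m"
  by (simp add: state_borel_def state_space_def space_PiM)

definition block :: "(nat \<Rightarrow> nat) \<Rightarrow> point \<Rightarrow> nat \<Rightarrow> real Matrix.vec" where
  "block m x k = Matrix.vec (m (k - 1)) (x k)"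

text \<open>Restriction of \<open>f\<close> to the line through \<open>x\<close> in the direction of coordinate \<open>j\<close> of block \<open>k\<close>.\<close>

definition coord_line :: "(point \<Rightarrow> real) \<Rightarrow> nat \<Rightarrow> nat \<Rightarrow> point \<Rightarrow> real \<Rightarrow> real" where
  "coord_line f k j x s = f (x(k := (x k)(j := s)))"

definition partial_deriv :: "nat \<Rightarrow> nat \<Rightarrow> (point \<Rightarrow> real) \<Rightarrow> point \<Rightarrow> real" where
  "partial_deriv k j f x = deriv (coord_line f k j x) (x k j)"

definition grad :: "(nat \<Rightarrow> nat) \<Rightarrow> nat \<Rightarrow> (point \<Rightarrow> real) \<Rightarrow> point \<Rightarrow> real Matrix.vec" where
  "grad m k f x = Matrix.vec (m (k - 1)) (\<lambda>j. partial_deriv k j f x)"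

primrec C_k :: "nat \<Rightarrow> (nat \<Rightarrow> nat) \<Rightarrow> nat \<Rightarrow> (point \<Rightarrow> real) \<Rightarrow> bool" where
  "C_k r m 0 f \<longleftrightarrow> continuous_on (state_space r m) f"
| "C_k r m (Suc n) f \<longleftrightarrow> continuous_on (state_space r m) f \<and>
     (\<forall>k\<in>{1..r + 1}. \<forall>j<m (k - 1).
        (\<forall>x\<in>state_space r m. coord_line f k j x differentiable at (x k j)) \<and>
        C_k r m n (partial_deriv k j f))"

definition bounded_second_derivs :: "nat \<Rightarrow> (nat \<Rightarrow> nat) \<Rightarrow> (point \<Rightarrow> real) \<Rightarrow> bool" where
  "bounded_second_derivs r m f \<longleftrightarrow>
     (\<forall>k\<in>{1..r + 1}. \<forall>j<m (k - 1). \<forall>k'\<in>{1..r + 1}. \<forall>j'<m (k' - 1).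
        bounded (partial_deriv k j (partial_deriv k' j' f) ` state_space r m))"

text \<open>
  The independence clause ranges over all coordinates and all disjoint increments at once: it
  gives independence of the increments over disjoint intervals and of the coordinates.
\<close>

definition std_brownian_motion ::
  "'w measure \<Rightarrow> nat \<Rightarrow> (real \<Rightarrow> 'w \<Rightarrow> nat \<Rightarrow> real) \<Rightarrow> bool" where
  "std_brownian_motion M n W \<longleftrightarrow>
     prob_space M \<and>
     (\<forall>t\<ge>0. \<forall>i<n. (\<lambda>\<omega>. W t \<omega> i) \<in> borel_measurable M) \<and>
     (AE \<omega> in M. \<forall>i<n. W 0 \<omega> i = 0 \<and> continuous_on {0..} (\<lambda>t. W t \<omega> i)) \<and>
     (\<forall>s t. \<forall>i<n. 0 \<le> s \<longrightarrow> s < t \<longrightarrow>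
        distributed M lborel (\<lambda>\<omega>. W t \<omega> i - W s \<omega> i) (normal_density 0 (sqrt (t - s)))) \<and>
     (\<forall>(\<tau> :: nat \<Rightarrow> real) l. 0 \<le> \<tau> 0 \<longrightarrow> (\<forall>q<l. \<tau> q < \<tau> (Suc q)) \<longrightarrow>
        prob_space.indep_vars M (\<lambda>_. borel)
          (\<lambda>(i, q) \<omega>. W (\<tau> (Suc q)) \<omega> i - W (\<tau> q) \<omega> i) ({..<n} \<times> {..<l}))"

text \<open>
  Solution started at \<open>x\<close> of \<open>dX\<^sub>1 = \<sigma> dW\<close>, \<open>dX\<^sub>k\<^sub>+\<^sub>1 = B\<^sub>k\<^sup>T X\<^sub>k dt\<close>, in integral form. As \<open>\<sigma>\<close> is
  constant, the stochastic integral of \<open>\<sigma>\<close> is \<open>\<sigma> (W t - W 0)\<close>.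
\<close>

definition solves_sde ::
  "'w measure \<Rightarrow> nat \<Rightarrow> (nat \<Rightarrow> nat) \<Rightarrow> real mat \<Rightarrow> (nat \<Rightarrow> real mat) \<Rightarrow>
   (real \<Rightarrow> 'w \<Rightarrow> nat \<Rightarrow> real) \<Rightarrow> point \<Rightarrow> (real \<Rightarrow> 'w \<Rightarrow> point) \<Rightarrow> bool" where
  "solves_sde M r m \<sigma> B W x X \<longleftrightarrow>
     (\<forall>t\<ge>0. X t \<in> measurable M (state_borel r m)) \<and>
     (AE \<omega> in M. \<forall>t\<ge>0.
        (\<forall>j<m 0. X t \<omega> 1 j =
           x 1 j + (\<sigma> *\<^sub>v Matrix.vec (m 0) (\<lambda>i. W t \<omega> i - W 0 \<omega> i)) $ j) \<and>
        (\<forall>k\<in>{1..r}. \<forall>j<m k.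
           ((\<lambda>s. (transpose_mat (B k) *\<^sub>v block m (X s \<omega>) k) $ j)
              has_integral (X t \<omega> (k + 1) j - x (k + 1) j)) {0..t}))"

text \<open>\<open>X x\<close> is the process started at \<open>x\<close>.\<close>

definition semigroup_of ::
  "'w measure \<Rightarrow> (point \<Rightarrow> real \<Rightarrow> 'w \<Rightarrow> point) \<Rightarrow> real \<Rightarrow> (point \<Rightarrow> real) \<Rightarrow> point \<Rightarrow> real" where
  "semigroup_of M X t f x = (\<integral>\<omega>. f (X x t \<omega>) \<partial>M)"

primrec ordered_prod :: "(nat \<Rightarrow> nat) \<Rightarrow> (nat \<Rightarrow> real mat) \<Rightarrow> nat \<Rightarrow> real mat" where
  "ordered_prod m B 0 = 1\<^sub>m (m 0)"
| "ordered_prod m B (Suc k) = ordered_prod m B k * B (Suc k)"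

definition mat_seminorm :: "real mat \<Rightarrow> real Matrix.vec \<Rightarrow> real" where
  "mat_seminorm A v = sqrt (scalar_prod v (A *\<^sub>v v))"

end

theory Submission
  imports Defs
begin

text \<open>
  The system is linear with additive noise, so two solutions driven by the same Brownian path
  differ by a deterministic amount: started at \<open>x + h v\<close> instead of \<open>x\<close>, the solution at time \<open>t\<close>
  is shifted by \<open>h \<Phi>\<^sub>t v\<close>, where \<open>\<Phi>\<^sub>t\<close> is the flow of the linear equation without noise
  (\<open>solution_depends_affinely_on_start\<close>). Integrating the drift block by block shows that the
  entry of \<open>\<Phi>\<^sub>t\<close> from block \<open>i\<close> to block \<open>k\<close> is the transpose of
  \<open>t\<^bsup>k-i\<^esup> / (k-i)! B\<^sub>i B\<^sub>i\<^sub>+\<^sub>1 \<dots> B\<^sub>k\<^sub>-\<^sub>1\<close>. Hence \<open>P\<^sub>t f (x + h v)\<close> is the expectation of \<open>f\<close> at a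
  shift of the solution from \<open>x\<close>, and differentiation under the expectation gives
  \<open>\<nabla>\<^bsup>(i)\<^esup> P\<^sub>t f = (\<Sum>k\<ge>i. t\<^bsup>k-i\<^esup> / (k-i)! B\<^sub>i \<dots> B\<^sub>k\<^sub>-\<^sub>1 P\<^sub>t \<nabla>\<^bsup>(k)\<^esup> f)\<close>
  (\<open>semigroup_partial_deriv\<close>). Multiplying by \<open>\<alpha>\<^sub>i B\<^sub>1 \<dots> B\<^sub>i\<^sub>-\<^sub>1\<close> completes each product to
  \<open>B\<^sub>1 \<dots> B\<^sub>k\<^sub>-\<^sub>1\<close>, and collecting the terms with the same \<open>k\<close> (\<open>collect_gradient_weights\<close>) shows
  that the vector on the left is the expectation of the vector on the right. As
  \<open>\<parallel>v\<parallel>\<^sup>2 = \<bar>\<sigma>\<^sup>T v\<bar>\<^sup>2\<close>, the inequality is \<open>(E U)\<^sup>2 \<le> E U\<^sup>2\<close> for each component \<open>U\<close> of \<open>\<sigma>\<^sup>T v\<close>.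

  Two analytic points remain. The derivative under the expectation comes from a Taylor expansion:
  bounded second derivatives make the remainder of the first-order expansion quadratic
  uniformly in the base point (\<open>taylor_remainder_bound\<close>), and the shift is deterministic, so the
  expected remainder is \<open>O(h\<^sup>2)\<close>. Integrability follows from the at most linear growth of the
  gradient once the solution has second moments; these pass through the time integrals by Fatou's
  lemma along Riemann sums (\<open>cont_L2_process_time_integral\<close>), which converge because the paths
  are continuous.
\<close>

section \<open>Functions with bounded second derivatives\<close>

definition coords :: "nat \<Rightarrow> (nat \<Rightarrow> nat) \<Rightarrow> (nat \<times> nat) set" where
  "coords r m = (SIGMA k:{1..r + 1}. {..<m (k - 1)})"

text \<open>
  Telescoping over the coordinates, which changes them one at a time, yields bounds in
  the \<open>\<ell>\<^sup>1\<close> distance.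
\<close>
definition l1_dist :: "nat \<Rightarrow> (nat \<Rightarrow> nat) \<Rightarrow> point \<Rightarrow> point \<Rightarrow> real" where
  "l1_dist r m x y = (\<Sum>(k, j)\<in>coords r m. \<bar>y k j - x k j\<bar>)"

lemma finite_coords [simp]: "finite (coords r m)"
  by (simp add: coords_def)

lemma l1_dist_nonneg: "0 \<le> l1_dist r m x y"
  unfolding l1_dist_def by (intro sum_nonneg) auto

lemma coord_le_l1_dist:
  assumes "(k, j) \<in> coords r m"
  shows "\<bar>y k j - x k j\<bar> \<le> l1_dist r m x y"
  unfolding l1_dist_def
  using member_le_sum[of "(k, j)" "coords r m" "\<lambda>(k, j). \<bar>y k j - x k j\<bar>"] assms by auto

lemma state_space_update:
  assumes "x \<in> state_space r m" "(k, j) \<in> coords r m"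
  shows "x(k := (x k)(j := s)) \<in> state_space r m"
  using assms by (auto simp: state_space_def coords_def PiE_def extensional_def Pi_def)

lemma state_space_eqI:
  assumes "x \<in> state_space r m" "y \<in> state_space r m"
    and "\<And>k j. (k, j) \<in> coords r m \<Longrightarrow> x k j = y k j"
  shows "x = y"
proof (intro ext)
  fix k j
  show "x k j = y k j"
  proof (cases "k \<in> {1..r + 1}")
    case True
    with assms(1,2) have "x k \<in> extensional {..<m (k - 1)}" "y k \<in> extensional {..<m (k - 1)}"
      by (auto simp: state_space_def PiE_def Pi_def)
    then show ?thesis
      using assms(3)[of k j] True by (cases "j < m (k - 1)") (auto simp: coords_def extensional_def)
  next
    case False
    with assms(1,2) have "x k = undefined" "y k = undefined"
      unfolding state_space_def by (auto dest: PiE_arb simp del: atLeastAtMost_iff)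
    then show ?thesis by simp
  qed
qed

text \<open>
  The points \<open>mix J x y\<close>, for an increasing chain of sets \<open>J\<close>, form a path from \<open>x\<close> to \<open>y\<close> along
  coordinate lines.
\<close>
definition mix :: "(nat \<times> nat) set \<Rightarrow> point \<Rightarrow> point \<Rightarrow> point" where
  "mix J x y = (\<lambda>k j. if (k, j) \<in> J then y k j else x k j)"

lemma mix_empty: "mix {} x y = x"
  by (simp add: mix_def)

lemma mix_insert: "mix (insert (k, j) J) x y = (mix J x y)(k := (mix J x y k)(j := y k j))"
  by (auto simp: mix_def fun_eq_iff)

lemma mix_in_state_space:
  assumes "x \<in> state_space r m" "finite J" "J \<subseteq> coords r m"
  shows "mix J x y \<in> state_space r m"
  using assms(2,3)
proof (induction J rule: finite_induct)
  case empty
  then show ?case by (simp add: mix_empty assms(1))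
next
  case (insert c J)
  then obtain k j where c: "c = (k, j)" "(k, j) \<in> coords r m" by (cases c) auto
  show ?case
    unfolding c(1) mix_insert by (rule state_space_update[OF insert.IH c(2)]) (use insert in simp)
qed

lemma mix_coords:
  assumes "x \<in> state_space r m" "y \<in> state_space r m"
  shows "mix (coords r m) x y = y"
  by (rule state_space_eqI[OF mix_in_state_space[OF assms(1)] assms(2)]) (auto simp: mix_def)

text \<open>
  The mean value inequality is applied on each coordinate segment of the path. The derivatives
  are bounded only on the box spanned by \<open>x\<close> and \<open>y\<close>, in which the whole path lies; the Taylor
  remainder below needs this locality, because its bound depends on the size of the box.
\<close>
lemma increment_bound_by_partials:
  fixes g :: "point \<Rightarrow> real" and d :: "nat \<Rightarrow> nat \<Rightarrow> point \<Rightarrow> real"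
  assumes x: "x \<in> state_space r m" and y: "y \<in> state_space r m"
    and deriv: "\<And>k j z. (k, j) \<in> coords r m \<Longrightarrow> z \<in> state_space r m \<Longrightarrow>
      (coord_line g k j z has_real_derivative d k j z) (at (z k j))"
    and bound: "\<And>k j z. (k, j) \<in> coords r m \<Longrightarrow> z \<in> state_space r m \<Longrightarrow>
      (\<And>p q. (p, q) \<in> coords r m \<Longrightarrow> \<bar>z p q - x p q\<bar> \<le> \<bar>y p q - x p q\<bar>) \<Longrightarrow>
      \<bar>d k j z\<bar> \<le> K"
  shows "\<bar>g y - g x\<bar> \<le> K * l1_dist r m x y"
proof -
  have "\<bar>g (mix J x y) - g x\<bar> \<le> K * (\<Sum>(k, j)\<in>J. \<bar>y k j - x k j\<bar>)"
    if "finite J" "J \<subseteq> coords r m" for J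
    using that
  proof (induction J rule: finite_induct)
    case empty
    then show ?case by (simp add: mix_empty)
  next
    case (insert c J)
    obtain k j where c: "c = (k, j)" by (cases c)
    let ?z = "mix J x y"
    let ?u = "\<lambda>s. ?z(k := (?z k)(j := s))"
    have kj: "(k, j) \<in> coords r m" and z: "?z \<in> state_space r m"
      using insert c by (auto intro: mix_in_state_space[OF x])
    have u: "?u s \<in> state_space r m" for s by (rule state_space_update[OF z kj])
    have old: "?z k j = x k j" using insert(2) c by (simp add: mix_def)
    \<comment> \<open>the restriction to a line does not depend on the base point chosen on it\<close>
    have line: "coord_line g k j (?u s) = coord_line g k j ?z" for s
      by (simp add: coord_line_def fun_eq_iff)
    have D: "(coord_line g k j ?z has_real_derivative d k j (?u s)) (at s)" for s
      using deriv[OF kj u[of s]] by (simp add: line)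
    have B: "\<bar>d k j (?u s)\<bar> \<le> K" if s: "s \<in> closed_segment (x k j) (y k j)" for s
    proof (rule bound[OF kj u])
      fix p q
      have "\<bar>s - x k j\<bar> \<le> \<bar>y k j - x k j\<bar>"
        using s by (auto simp: closed_segment_eq_real_ivl split: if_splits)
      then show "\<bar>?u s p q - x p q\<bar> \<le> \<bar>y p q - x p q\<bar>"
        by (auto simp: mix_def)
    qed
    have "norm (coord_line g k j ?z (y k j) - coord_line g k j ?z (x k j))
        \<le> K * norm (y k j - x k j)"
      by (rule field_differentiable_bound[of "closed_segment (x k j) (y k j)"])
        (use D B in \<open>auto intro: has_field_derivative_at_within\<close>)
    moreover have "coord_line g k j ?z (y k j) = g (mix (insert c J) x y)"
      by (simp add: coord_line_def c mix_insert)
    moreover have "coord_line g k j ?z (x k j) = g ?z"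
      by (simp add: coord_line_def flip: old)
    moreover have "\<bar>g ?z - g x\<bar> \<le> K * (\<Sum>(k, j)\<in>J. \<bar>y k j - x k j\<bar>)"
      using insert by auto
    ultimately show ?case
      using insert(1,2) by (auto simp: c algebra_simps)
  qed
  from this[OF finite_coords subset_refl] show ?thesis
    by (simp add: mix_coords[OF x y] l1_dist_def)
qed

lemma C_Suc_coord_line_derivative:
  assumes "C_k r m (Suc n) f" "(k, j) \<in> coords r m" "z \<in> state_space r m"
  shows "(coord_line f k j z has_real_derivative partial_deriv k j f z) (at (z k j))"
proof -
  have "coord_line f k j z differentiable at (z k j)"
    using assms by (simp add: coords_def)
  then show ?thesis
    by (simp add: partial_deriv_def DERIV_deriv_iff_real_differentiable)
qed

lemma C_Suc_partial_deriv:
  assumes "C_k r m (Suc n) f" "(k, j) \<in> coords r m"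
  shows "C_k r m n (partial_deriv k j f)"
  using assms by (simp add: coords_def)

lemma C_k_continuous: "C_k r m n f \<Longrightarrow> continuous_on (state_space r m) f"
  by (cases n) auto

lemma second_derivs_uniform_bound:
  assumes "bounded_second_derivs r m f"
  obtains K where "K \<ge> 0"
    "\<And>k j p q z. (k, j) \<in> coords r m \<Longrightarrow> (p, q) \<in> coords r m \<Longrightarrow> z \<in> state_space r m \<Longrightarrow>
       \<bar>partial_deriv k j (partial_deriv p q f) z\<bar> \<le> K"
proof -
  have "bounded (\<Union>(k, j)\<in>coords r m. \<Union>(p, q)\<in>coords r m.
          partial_deriv k j (partial_deriv p q f) ` state_space r m)"
    using assms by (auto intro!: bounded_UN simp: bounded_second_derivs_def coords_def)
  then obtain K where K: "K > 0"
    "\<forall>v\<in>(\<Union>(k, j)\<in>coords r m. \<Union>(p, q)\<in>coords r m.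
          partial_deriv k j (partial_deriv p q f) ` state_space r m). norm v \<le> K"
    by (auto simp: bounded_pos)
  show thesis
    by (rule that[of K]) (use K in \<open>fastforce+\<close>)
qed

lemma partial_deriv_lipschitz:
  assumes C2: "C_k r m 2 f"
    and K: "\<And>k j p q z. (k, j) \<in> coords r m \<Longrightarrow> (p, q) \<in> coords r m \<Longrightarrow> z \<in> state_space r m \<Longrightarrow>
       \<bar>partial_deriv k j (partial_deriv p q f) z\<bar> \<le> K"
    and c: "(p, q) \<in> coords r m" and x: "x \<in> state_space r m" and y: "y \<in> state_space r m"
  shows "\<bar>partial_deriv p q f y - partial_deriv p q f x\<bar> \<le> K * l1_dist r m x y"
proof -
  have C1: "C_k r m (Suc 0) (partial_deriv p q f)"
    using C_Suc_partial_deriv[of r m "Suc 0" f] C2 c by (simp only: numeral_2_eq_2)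
  show ?thesis
    by (rule increment_bound_by_partials[OF x y C_Suc_coord_line_derivative[OF C1]])
      (auto intro: K c)
qed

text \<open>
  Subtracting the linear part of the expansion leaves a function whose partial derivatives on the box
  between \<open>x\<close> and \<open>y\<close> are at most \<open>K\<close> times the distance of \<open>x\<close> and \<open>y\<close>, by the Lipschitz bound;
  the increment bound contributes the second factor. The constant does not depend on \<open>x\<close>, so the
  estimate survives when \<open>x\<close> is replaced by a random point.
\<close>
lemma taylor_remainder_bound:
  assumes C2: "C_k r m 2 f"
    and K: "\<And>k j p q z. (k, j) \<in> coords r m \<Longrightarrow> (p, q) \<in> coords r m \<Longrightarrow> z \<in> state_space r m \<Longrightarrow>
       \<bar>partial_deriv k j (partial_deriv p q f) z\<bar> \<le> K"
    and K0: "K \<ge> 0" and x: "x \<in> state_space r m" and y: "y \<in> state_space r m"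
  shows "\<bar>f y - f x - (\<Sum>(k, j)\<in>coords r m. partial_deriv k j f x * (y k j - x k j))\<bar>
    \<le> K * (l1_dist r m x y)\<^sup>2"
proof -
  define L :: "point \<Rightarrow> real"
    where "L z = (\<Sum>(p, q)\<in>coords r m. partial_deriv p q f x * z p q)" for z
  have dL: "(coord_line L k j z has_real_derivative partial_deriv k j f x) (at s)"
    if kj: "(k, j) \<in> coords r m" for k j z s
  proof -
    have "((\<lambda>s. \<Sum>c\<in>coords r m. partial_deriv (fst c) (snd c) f x * (z(k := (z k)(j := s))) (fst c) (snd c))
        has_real_derivative (\<Sum>c\<in>coords r m. if c = (k, j) then partial_deriv k j f x else 0)) (at s)"
    proof (rule DERIV_sum)
      fix c
      show "((\<lambda>s. partial_deriv (fst c) (snd c) f x * (z(k := (z k)(j := s))) (fst c) (snd c))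
        has_real_derivative (if c = (k, j) then partial_deriv k j f x else 0)) (at s)"
      proof (cases "c = (k, j)")
        case True
        then show ?thesis by (auto intro!: derivative_eq_intros)
      next
        case False
        then have "(z(k := (z k)(j := s))) (fst c) (snd c) = z (fst c) (snd c)" for s
          by (cases c) auto
        then show ?thesis using False by simp
      qed
    qed
    then show ?thesis
      using kj by (simp add: coord_line_def[abs_def] L_def case_prod_beta)
  qed
  have lip: "\<bar>partial_deriv k j f z - partial_deriv k j f x\<bar> \<le> K * l1_dist r m x y"
    if kj: "(k, j) \<in> coords r m" and z: "z \<in> state_space r m"
      and box: "\<And>p q. (p, q) \<in> coords r m \<Longrightarrow> \<bar>z p q - x p q\<bar> \<le> \<bar>y p q - x p q\<bar>" for k j z
  proof -
    have "l1_dist r m x z \<le> l1_dist r m x y"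
      unfolding l1_dist_def by (intro sum_mono) (auto intro: box)
    then show ?thesis
      using partial_deriv_lipschitz[OF C2 K kj x z] K0 by (meson mult_left_mono order_trans)
  qed
  have df: "(coord_line f k j z has_real_derivative partial_deriv k j f z) (at (z k j))"
    if "(k, j) \<in> coords r m" "z \<in> state_space r m" for k j z
    using C_Suc_coord_line_derivative[of r m "Suc 0" f] that C2 by (simp only: numeral_2_eq_2)
  have "\<bar>(f y - L y) - (f x - L x)\<bar> \<le> (K * l1_dist r m x y) * l1_dist r m x y"
  proof (rule increment_bound_by_partials[where g = "\<lambda>z. f z - L z"
        and d = "\<lambda>k j z. partial_deriv k j f z - partial_deriv k j f x", OF x y])
    fix k j z assume kj: "(k, j) \<in> coords r m" and z: "z \<in> state_space r m"
    show "(coord_line (\<lambda>z. f z - L z) k j z has_real_derivative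
        partial_deriv k j f z - partial_deriv k j f x) (at (z k j))"
      using DERIV_diff[OF df[OF kj z] dL[OF kj, of z "z k j"]] by (simp add: coord_line_def[abs_def])
  qed (use lip in blast)
  moreover have "L y - L x = (\<Sum>(k, j)\<in>coords r m. partial_deriv k j f x * (y k j - x k j))"
    by (simp add: L_def sum_subtractf algebra_simps case_prod_beta)
  ultimately show ?thesis
    by (simp add: power2_eq_square algebra_simps)
qed

text \<open>
  This bound and the next one reduce the integrability of \<open>f\<close> along the solution, and the square
  integrability of its gradient, to second moments of the solution.
\<close>
lemma quadratic_growth:
  assumes C2: "C_k r m 2 f" and bd: "bounded_second_derivs r m f" and x: "x \<in> state_space r m"
  obtains a b where "\<And>y. y \<in> state_space r m \<Longrightarrow> \<bar>f y\<bar> \<le> a + b * (l1_dist r m x y)\<^sup>2"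
proof -
  obtain K where K: "K \<ge> 0"
    "\<And>k j p q z. (k, j) \<in> coords r m \<Longrightarrow> (p, q) \<in> coords r m \<Longrightarrow> z \<in> state_space r m \<Longrightarrow>
       \<bar>partial_deriv k j (partial_deriv p q f) z\<bar> \<le> K"
    using second_derivs_uniform_bound[OF bd] by blast
  define G where "G = (\<Sum>(k, j)\<in>coords r m. \<bar>partial_deriv k j f x\<bar>)"
  have "\<bar>f y\<bar> \<le> (\<bar>f x\<bar> + G) + (G + K) * (l1_dist r m x y)\<^sup>2" if y: "y \<in> state_space r m" for y
  proof -
    let ?n = "l1_dist r m x y"
    have "\<bar>\<Sum>(k, j)\<in>coords r m. partial_deriv k j f x * (y k j - x k j)\<bar>
        \<le> (\<Sum>(k, j)\<in>coords r m. \<bar>partial_deriv k j f x\<bar> * ?n)"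
      by (rule order_trans[OF sum_abs], rule sum_mono)
        (auto simp: abs_mult intro!: mult_left_mono coord_le_l1_dist)
    also have "\<dots> = G * ?n" by (simp add: G_def sum_distrib_right case_prod_beta)
    finally have 1: "\<bar>\<Sum>(k, j)\<in>coords r m. partial_deriv k j f x * (y k j - x k j)\<bar> \<le> G * ?n" .
    \<comment> \<open>the linear term of the expansion is absorbed by \<open>?n \<le> 1 + ?n\<^sup>2\<close>\<close>
    have "0 \<le> (?n - 1)\<^sup>2" by simp
    then have "?n \<le> 1 + ?n\<^sup>2" using l1_dist_nonneg[of r m x y] by (simp add: power2_diff)
    moreover have "G \<ge> 0" unfolding G_def by (intro sum_nonneg) auto
    ultimately have "G * ?n \<le> G * (1 + ?n\<^sup>2)" by (rule mult_left_mono)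
    with 1 taylor_remainder_bound[OF C2 K(2,1) x y] show ?thesis
      by (simp add: algebra_simps)
  qed
  then show thesis by (rule that)
qed

lemma partial_deriv_square_growth:
  assumes C2: "C_k r m 2 f" and bd: "bounded_second_derivs r m f" and x: "x \<in> state_space r m"
    and c: "(k, j) \<in> coords r m"
  obtains a b where
    "\<And>y. y \<in> state_space r m \<Longrightarrow> \<bar>(partial_deriv k j f y)\<^sup>2\<bar> \<le> a + b * (l1_dist r m x y)\<^sup>2"
proof -
  obtain K where K: "K \<ge> 0"
    "\<And>k j p q z. (k, j) \<in> coords r m \<Longrightarrow> (p, q) \<in> coords r m \<Longrightarrow> z \<in> state_space r m \<Longrightarrow>
       \<bar>partial_deriv k j (partial_deriv p q f) z\<bar> \<le> K"
    using second_derivs_uniform_bound[OF bd] by blast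
  let ?g = "partial_deriv k j f"
  have "\<bar>(?g y)\<^sup>2\<bar> \<le> 2 * (?g x)\<^sup>2 + 2 * K\<^sup>2 * (l1_dist r m x y)\<^sup>2" if y: "y \<in> state_space r m" for y
  proof -
    have "\<bar>?g y - ?g x\<bar> \<le> \<bar>K * l1_dist r m x y\<bar>"
      using partial_deriv_lipschitz[OF C2 K(2) c x y] by linarith
    then have "(?g y - ?g x)\<^sup>2 \<le> (K * l1_dist r m x y)\<^sup>2" by (simp only: abs_le_square_iff)
    \<comment> \<open>expanded, this is \<open>(?g y)\<^sup>2 \<le> 2 (?g x)\<^sup>2 + 2 (?g y - ?g x)\<^sup>2\<close>\<close>
    moreover have "0 \<le> (?g y - 2 * ?g x)\<^sup>2" by simp
    ultimately show ?thesis by (simp add: power2_eq_square algebra_simps)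
  qed
  then show thesis by (rule that)
qed

section \<open>Measurability on the state space\<close>

lemma measurable_state_coordinate:
  assumes "(k, j) \<in> coords r m"
  shows "(\<lambda>x. x k j) \<in> borel_measurable (state_borel r m)"
proof -
  have "(\<lambda>x. x k) \<in> measurable (state_borel r m) (PiM {..<m (k - 1)} (\<lambda>_. borel))"
    unfolding state_borel_def
    by (rule measurable_component_singleton) (use assms in \<open>simp add: coords_def\<close>)
  then show ?thesis
    by (rule measurable_compose[OF _ measurable_component_singleton])
      (use assms in \<open>simp add: coords_def\<close>)
qed

text \<open>
  The identity maps the product \<open>\<sigma>\<close>-algebra of the state space measurably to the Borel
  \<open>\<sigma>\<close>-algebra of the full function space: the coordinates outside the state space take a constant
  value on it.
\<close>
lemma continuous_on_state_space_measurable: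
  assumes "continuous_on (state_space r m) f"
  shows "f \<in> borel_measurable (state_borel r m)"
proof -
  have coord: "(\<lambda>x. x k j) \<in> borel_measurable (state_borel r m)" for k j
  proof (cases "(k, j) \<in> coords r m")
    case False
    have "x k j = (if k \<in> {1..r + 1} then undefined else (undefined :: nat \<Rightarrow> real) j)"
      if "x \<in> state_space r m" for x
    proof (cases "k \<in> {1..r + 1}")
      case True
      with that False have "x k \<in> extensional {..<m (k - 1)}" "j \<notin> {..<m (k - 1)}"
        by (auto simp: state_space_def coords_def PiE_def Pi_def)
      with True show ?thesis by (simp add: extensional_def)
    next
      case False
      with that have "x k = undefined"
        unfolding state_space_def by (auto dest: PiE_arb simp del: atLeastAtMost_iff)
      with False show ?thesis by auto
    qed
    then show ?thesis
      by (subst measurable_cong[where g = "\<lambda>_. if k \<in> {1..r + 1} then undefined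
          else (undefined :: nat \<Rightarrow> real) j"])
        (auto simp: space_state_borel)
  qed (rule measurable_state_coordinate)
  have "(\<lambda>x. x) \<in> measurable (state_borel r m) (borel :: point measure)"
    by (intro measurable_coordinatewise_then_product coord)
  then have "(\<lambda>x. x) \<in> measurable (state_borel r m) (restrict_space borel (state_space r m))"
    by (intro measurable_restrict_space2) (auto simp: space_state_borel)
  from measurable_compose[OF this borel_measurable_continuous_on_restrict[OF assms]]
  show ?thesis .
qed

lemma C_2_measurable:
  assumes "C_k r m 2 f"
  shows "f \<in> borel_measurable (state_borel r m)"
    and "(k, j) \<in> coords r m \<Longrightarrow> partial_deriv k j f \<in> borel_measurable (state_borel r m)"
proof -
  have C: "C_k r m (Suc (Suc 0)) f" using assms by (simp only: numeral_2_eq_2)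
  show "f \<in> borel_measurable (state_borel r m)"
    by (rule continuous_on_state_space_measurable[OF C_k_continuous[OF C]])
  show "partial_deriv k j f \<in> borel_measurable (state_borel r m)" if "(k, j) \<in> coords r m"
    by (rule continuous_on_state_space_measurable[OF C_k_continuous[OF C_Suc_partial_deriv[OF C that]]])
qed

section \<open>Continuous processes with bounded second moments\<close>

text \<open>
  By uniform continuity, the error on each cell is at most \<open>\<epsilon>\<close> times its length.
\<close>
lemma riemann_sums_converge:
  fixes g :: "real \<Rightarrow> real"
  assumes cont: "continuous_on {0..T} g" and T: "0 \<le> T" and int: "(g has_integral I) {0..T}"
  shows "(\<lambda>n. T / real (Suc n) * (\<Sum>p<Suc n. g (real p * T / real (Suc n)))) \<longlonglongrightarrow> I"
proof (rule LIMSEQ_I)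
  fix e :: real assume e: "e > 0"
  define \<epsilon> where "\<epsilon> = e / (T + 1)"
  have \<epsilon>: "\<epsilon> > 0" "T * \<epsilon> < e" using e T by (auto simp: \<epsilon>_def field_simps)
  have "uniformly_continuous_on {0..T} g"
    by (rule compact_uniformly_continuous[OF cont]) simp
  then obtain d where d: "d > 0"
    "\<And>u v. u \<in> {0..T} \<Longrightarrow> v \<in> {0..T} \<Longrightarrow> dist v u < d \<Longrightarrow> dist (g v) (g u) < \<epsilon>"
    using \<epsilon>(1) unfolding uniformly_continuous_on_def by metis
  obtain N where N: "T / real (Suc N) < d"
  proof -
    obtain N :: nat where "T / d < real N" using reals_Archimedean2 by blast
    then have "T / d < real (Suc N)" by simp
    then have "T / real (Suc N) < d" using d(1) by (simp add: field_simps)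
    then show thesis by (rule that)
  qed
  show "\<exists>no. \<forall>n\<ge>no. norm (T / real (Suc n) * (\<Sum>p<Suc n. g (real p * T / real (Suc n))) - I) < e"
  proof (intro exI allI impI)
    fix n assume n: "n \<ge> N"
    define h where "h = T / real (Suc n)"
    have h0: "h \<ge> 0" using T by (simp add: h_def)
    have hN: "h \<le> T / real (Suc N)" unfolding h_def using n T by (intro divide_left_mono) auto
    have hd: "h < d" using hN N by simp
    have hT: "real (Suc n) * h = T" by (simp add: h_def)
    have ph: "real p * h \<le> T" if "p \<le> Suc n" for p
      using mult_right_mono[of "real p" "real (Suc n)" h] that h0 hT by simp
    \<comment> \<open>the integral over the first \<open>q\<close> cells, against the first \<open>q\<close> terms of the sum\<close>
    have "\<bar>integral {0..real q * h} g - h * (\<Sum>p<q. g (real p * h))\<bar> \<le> real q * (\<epsilon> * h)"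
      if "q \<le> Suc n" for q
      using that
    proof (induction q)
      case 0
      then show ?case by simp
    next
      case (Suc q)
      let ?a = "real q * h" and ?b = "real (Suc q) * h"
      have ab: "0 \<le> ?a" "?a \<le> ?b" "?b \<le> T" "?b - ?a = h" "?b = ?a + h"
        using h0 ph[OF Suc.prems] by (auto simp: algebra_simps)
      have gi: "g integrable_on {0..?b}"
        by (rule integrable_continuous_real, rule continuous_on_subset[OF cont]) (use ab in auto)
      have split: "integral {0..?b} g = integral {0..?a} g + integral {?a..?b} g"
        using Henstock_Kurzweil_Integration.integral_combine[OF ab(1,2) gi] by simp
      have gab: "g integrable_on {?a..?b}"
        by (rule integrable_continuous_real, rule continuous_on_subset[OF cont]) (use ab in auto)
      have "\<bar>integral {?a..?b} (\<lambda>u. g u - g ?a)\<bar> \<le> \<epsilon> * (?b - ?a)"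
      proof (rule integral_bound[of ?a ?b "\<lambda>u. g u - g ?a" \<epsilon>, unfolded real_norm_def])
        show "?a \<le> ?b" by fact
        show "continuous_on {?a..?b} (\<lambda>u. g u - g ?a)"
          by (intro continuous_intros continuous_on_subset[OF cont]) (use ab in auto)
        fix u assume u: "u \<in> {?a..?b}"
        have "dist u ?a < d" using u ab(5) hd by (simp add: dist_real_def)
        moreover have "u \<in> {0..T}" "?a \<in> {0..T}" using u ab order_trans[OF ab(1)] by auto
        ultimately show "\<bar>g u - g ?a\<bar> \<le> \<epsilon>" using d(2)[of ?a u] by (simp add: dist_real_def)
      qed
      moreover have "integral {?a..?b} (\<lambda>u. g u - g ?a) = integral {?a..?b} g - h * g ?a"
      proof (subst Henstock_Kurzweil_Integration.integral_diff[OF gab integrable_const_ivl])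
        show "integral {?a..?b} g - integral {?a..?b} (\<lambda>u. g ?a) = integral {?a..?b} g - h * g ?a"
          using ab(2,4) by simp
      qed
      ultimately have "\<bar>integral {?a..?b} g - h * g ?a\<bar> \<le> \<epsilon> * h"
        using ab(4) by simp
      with Suc.IH Suc.prems show ?case
        unfolding split by (auto simp: algebra_simps)
    qed
    from this[of "Suc n"] have "\<bar>I - h * (\<Sum>p<Suc n. g (real p * h))\<bar> \<le> T * \<epsilon>"
      unfolding hT using integral_unique[OF int] hT by (simp add: mult.assoc mult.commute mult.left_commute)
    with \<epsilon>(2) show "norm (T / real (Suc n) * (\<Sum>p<Suc n. g (real p * T / real (Suc n))) - I) < e"
      by (simp add: h_def abs_minus_commute)
  qed
qed

text \<open>
  This class of processes contains Brownian motion and is closed under the operations that build the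
  solution block by block. The second moments have to be bounded uniformly in time for the
  closure under time integrals.
\<close>
definition cont_L2_process :: "'w measure \<Rightarrow> real \<Rightarrow> (real \<Rightarrow> 'w \<Rightarrow> real) \<Rightarrow> bool" where
  "cont_L2_process M T Y \<longleftrightarrow>
     (\<forall>s\<in>{0..T}. Y s \<in> borel_measurable M) \<and>
     (AE \<omega> in M. continuous_on {0..T} (\<lambda>s. Y s \<omega>)) \<and>
     (\<exists>C::real. \<forall>s\<in>{0..T}. (\<integral>\<^sup>+\<omega>. ennreal ((Y s \<omega>)\<^sup>2) \<partial>M) \<le> ennreal C)"

lemma cont_L2_process_integrable_square:
  assumes "cont_L2_process M T Y" "s \<in> {0..T}"
  shows "integrable M (\<lambda>\<omega>. (Y s \<omega>)\<^sup>2)"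
proof (rule integrableI_nonneg)
  have "Y s \<in> borel_measurable M" using assms by (simp add: cont_L2_process_def)
  then show "(\<lambda>\<omega>. (Y s \<omega>)\<^sup>2) \<in> borel_measurable M" by measurable
  from assms obtain C :: real where "(\<integral>\<^sup>+\<omega>. ennreal ((Y s \<omega>)\<^sup>2) \<partial>M) \<le> ennreal C"
    unfolding cont_L2_process_def by blast
  then show "(\<integral>\<^sup>+\<omega>. ennreal ((Y s \<omega>)\<^sup>2) \<partial>M) < \<infinity>"
    by (rule order.strict_trans1) simp
qed simp

lemma cont_L2_process_const:
  assumes "prob_space M"
  shows "cont_L2_process M T (\<lambda>_ _. c)"
proof -
  interpret prob_space M by fact
  show ?thesis by (auto simp: cont_L2_process_def emeasure_space_1 intro!: exI[of _ "c\<^sup>2"])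
qed

lemma cont_L2_process_linear_combination:
  assumes "finite I" and Y: "\<And>i. i \<in> I \<Longrightarrow> cont_L2_process M T (Y i)"
  shows "cont_L2_process M T (\<lambda>s \<omega>. \<Sum>i\<in>I. b i * Y i s \<omega>)"
  unfolding cont_L2_process_def
proof (intro conjI ballI)
  have meas: "Y i s \<in> borel_measurable M" if "i \<in> I" "s \<in> {0..T}" for i s
    using Y[OF that(1)] that(2) by (simp add: cont_L2_process_def)
  then show "(\<lambda>\<omega>. \<Sum>i\<in>I. b i * Y i s \<omega>) \<in> borel_measurable M" if "s \<in> {0..T}" for s
    using that by measurable
  have "AE \<omega> in M. \<forall>i\<in>I. continuous_on {0..T} (\<lambda>s. Y i s \<omega>)"
    using Y by (intro AE_finite_allI[OF assms(1)]) (simp add: cont_L2_process_def)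
  then show "AE \<omega> in M. continuous_on {0..T} (\<lambda>s. \<Sum>i\<in>I. b i * Y i s \<omega>)"
    by eventually_elim (intro continuous_intros, auto)
  have "\<forall>i\<in>I. \<exists>C::real. \<forall>s\<in>{0..T}. (\<integral>\<^sup>+\<omega>. ennreal ((Y i s \<omega>)\<^sup>2) \<partial>M) \<le> ennreal C"
    using Y by (simp add: cont_L2_process_def)
  then obtain C :: "_ \<Rightarrow> real"
    where C: "\<And>i s. i \<in> I \<Longrightarrow> s \<in> {0..T} \<Longrightarrow> (\<integral>\<^sup>+\<omega>. ennreal ((Y i s \<omega>)\<^sup>2) \<partial>M) \<le> ennreal (C i)"
    by metis
  let ?b = "\<Sum>i\<in>I. (b i)\<^sup>2"
  have b0: "0 \<le> ?b" by (intro sum_nonneg) auto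
  show "\<exists>C::real. \<forall>s\<in>{0..T}. (\<integral>\<^sup>+\<omega>. ennreal ((\<Sum>i\<in>I. b i * Y i s \<omega>)\<^sup>2) \<partial>M) \<le> ennreal C"
  proof (intro exI ballI)
    fix s assume s: "s \<in> {0..T}"
    have "(\<integral>\<^sup>+\<omega>. ennreal ((\<Sum>i\<in>I. b i * Y i s \<omega>)\<^sup>2) \<partial>M)
        \<le> (\<integral>\<^sup>+\<omega>. ennreal ?b * (\<Sum>i\<in>I. ennreal ((Y i s \<omega>)\<^sup>2)) \<partial>M)"
      using Cauchy_Schwarz_ineq_sum[of b "\<lambda>i. Y i s _" I]
      by (intro nn_integral_mono) (simp add: b0 ennreal_mult[symmetric] sum_nonneg sum_ennreal)
    also have "\<dots> = ennreal ?b * (\<Sum>i\<in>I. \<integral>\<^sup>+\<omega>. ennreal ((Y i s \<omega>)\<^sup>2) \<partial>M)"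
      using meas s by (subst nn_integral_cmult, measurable, subst nn_integral_sum) auto
    also have "\<dots> \<le> ennreal ?b * (\<Sum>i\<in>I. ennreal \<bar>C i\<bar>)"
      using C s by (intro mult_left_mono sum_mono order_trans[OF _ ennreal_leI[OF abs_ge_self]]) auto
    also have "\<dots> = ennreal (?b * (\<Sum>i\<in>I. \<bar>C i\<bar>))"
      by (simp add: b0 ennreal_mult sum_nonneg sum_ennreal)
    finally show "(\<integral>\<^sup>+\<omega>. ennreal ((\<Sum>i\<in>I. b i * Y i s \<omega>)\<^sup>2) \<partial>M) \<le> ennreal (?b * (\<Sum>i\<in>I. \<bar>C i\<bar>))" .
  qed
qed

lemma cont_L2_process_add:
  assumes "cont_L2_process M T Y" "cont_L2_process M T Z"
  shows "cont_L2_process M T (\<lambda>s \<omega>. Y s \<omega> + Z s \<omega>)"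
  using cont_L2_process_linear_combination[of UNIV M T "\<lambda>b. if b then Y else Z" "\<lambda>_. 1"] assms
  by (simp add: UNIV_bool add.commute)

lemma cont_L2_process_modification:
  assumes Y: "cont_L2_process M T Y"
    and meas: "\<And>s. s \<in> {0..T} \<Longrightarrow> Z s \<in> borel_measurable M"
    and eq: "AE \<omega> in M. \<forall>s\<in>{0..T}. Z s \<omega> = Y s \<omega>"
  shows "cont_L2_process M T Z"
  unfolding cont_L2_process_def
proof (intro conjI ballI)
  have "AE \<omega> in M. continuous_on {0..T} (\<lambda>s. Y s \<omega>)" using Y by (simp add: cont_L2_process_def)
  with eq show "AE \<omega> in M. continuous_on {0..T} (\<lambda>s. Z s \<omega>)"
    by eventually_elim (metis (no_types, lifting) continuous_on_cong)
  have "(\<integral>\<^sup>+\<omega>. ennreal ((Z s \<omega>)\<^sup>2) \<partial>M) = (\<integral>\<^sup>+\<omega>. ennreal ((Y s \<omega>)\<^sup>2) \<partial>M)" if "s \<in> {0..T}" for s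
    by (rule nn_integral_cong_AE) (use eq that in \<open>auto elim: eventually_mono\<close>)
  then show "\<exists>C::real. \<forall>s\<in>{0..T}. (\<integral>\<^sup>+\<omega>. ennreal ((Z s \<omega>)\<^sup>2) \<partial>M) \<le> ennreal C"
    using Y by (simp add: cont_L2_process_def)
qed (rule meas)

text \<open>
  Each Riemann sum has second moment at most \<open>T\<^sup>2 C\<close>, if \<open>C\<close> bounds the second moments of \<open>g\<close>;
  Fatou's lemma carries the bound over to the integral.
\<close>
lemma cont_L2_process_time_integral:
  assumes g: "cont_L2_process M T g"
    and meas: "\<And>s. s \<in> {0..T} \<Longrightarrow> Z s \<in> borel_measurable M"
    and int: "AE \<omega> in M. \<forall>s\<in>{0..T}. ((\<lambda>u. g u \<omega>) has_integral Z s \<omega>) {0..s}"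
  shows "cont_L2_process M T Z"
  unfolding cont_L2_process_def
proof (intro conjI ballI)
  have cont: "AE \<omega> in M. continuous_on {0..T} (\<lambda>s. g s \<omega>)" using g by (simp add: cont_L2_process_def)
  from cont int show "AE \<omega> in M. continuous_on {0..T} (\<lambda>s. Z s \<omega>)"
  proof eventually_elim
    case (elim \<omega>)
    have "continuous_on {0..T} (\<lambda>s. integral {0..s} (\<lambda>u. g u \<omega>))"
      by (intro indefinite_integral_continuous_1 integrable_continuous_real elim)
    moreover have "\<forall>s\<in>{0..T}. integral {0..s} (\<lambda>u. g u \<omega>) = Z s \<omega>"
      using elim(2) by (blast intro: integral_unique)
    ultimately show ?case by (simp only: continuous_on_eq)
  qed
  obtain C' :: real where C': "\<And>s. s \<in> {0..T} \<Longrightarrow> (\<integral>\<^sup>+\<omega>. ennreal ((g s \<omega>)\<^sup>2) \<partial>M) \<le> ennreal C'"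
    using g unfolding cont_L2_process_def by blast
  define C where "C = \<bar>C'\<bar>"
  have C0: "C \<ge> 0" and C: "\<And>s. s \<in> {0..T} \<Longrightarrow> (\<integral>\<^sup>+\<omega>. ennreal ((g s \<omega>)\<^sup>2) \<partial>M) \<le> ennreal C"
    using order_trans[OF C' ennreal_leI[OF abs_ge_self]] by (auto simp: C_def)
  show "\<exists>C::real. \<forall>s\<in>{0..T}. (\<integral>\<^sup>+\<omega>. ennreal ((Z s \<omega>)\<^sup>2) \<partial>M) \<le> ennreal C"
  proof (intro exI ballI)
    fix s assume s: "s \<in> {0..T}"
    define R where "R n \<omega> = s / real (Suc n) * (\<Sum>p<Suc n. g (real p * s / real (Suc n)) \<omega>)" for n \<omega>
    have node: "real p * s / real (Suc n) \<in> {0..T}" if "p < Suc n" for p n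
    proof -
      have "real p * s \<le> real (Suc n) * s" using that s by (intro mult_right_mono) auto
      then have "real p * s / real (Suc n) \<le> s" by (simp add: field_simps)
      with s show ?thesis by simp
    qed
    have gm: "g (real p * s / real (Suc n)) \<in> borel_measurable M" if "p < Suc n" for p n
      using g node[OF that] by (simp add: cont_L2_process_def)
    have Rm[measurable]: "R n \<in> borel_measurable M" for n
      unfolding R_def[abs_def] using gm
      by (intro borel_measurable_times borel_measurable_sum) auto
    \<comment> \<open>by the inequality between the arithmetic and the quadratic mean\<close>
    have Rb: "(\<integral>\<^sup>+\<omega>. ennreal ((R n \<omega>)\<^sup>2) \<partial>M) \<le> ennreal (T\<^sup>2 * C)" for n
    proof -
      let ?N = "real (Suc n)"
      have "(\<integral>\<^sup>+\<omega>. ennreal ((R n \<omega>)\<^sup>2) \<partial>M)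
        \<le> (\<integral>\<^sup>+\<omega>. ennreal (s\<^sup>2 / ?N) * (\<Sum>p<Suc n. ennreal ((g (real p * s / ?N) \<omega>)\<^sup>2)) \<partial>M)"
      proof (rule nn_integral_mono)
        fix \<omega>
        have "(R n \<omega>)\<^sup>2 = (s / ?N)\<^sup>2 * (\<Sum>p<Suc n. g (real p * s / ?N) \<omega>)\<^sup>2"
          by (simp only: R_def power_mult_distrib)
        also have "\<dots> \<le> (s / ?N)\<^sup>2 * ((\<Sum>p<Suc n. (g (real p * s / ?N) \<omega>)\<^sup>2) * real (card {..<Suc n}))"
          by (intro mult_left_mono sum_squared_le_sum_of_squares) simp
        also have "\<dots> = s\<^sup>2 / ?N * (\<Sum>p<Suc n. (g (real p * s / ?N) \<omega>)\<^sup>2)"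
          by (simp only: card_lessThan) (simp add: power2_eq_square divide_simps del: sum.lessThan_Suc)
        finally have "(R n \<omega>)\<^sup>2 \<le> s\<^sup>2 / ?N * (\<Sum>p<Suc n. (g (real p * s / ?N) \<omega>)\<^sup>2)" .
        then show "ennreal ((R n \<omega>)\<^sup>2)
            \<le> ennreal (s\<^sup>2 / ?N) * (\<Sum>p<Suc n. ennreal ((g (real p * s / ?N) \<omega>)\<^sup>2))"
          by (subst sum_ennreal, simp, subst ennreal_mult[symmetric])
            (auto intro!: sum_nonneg ennreal_leI simp del: sum.lessThan_Suc of_nat_Suc)
      qed
      also have "\<dots> = ennreal (s\<^sup>2 / ?N) * (\<Sum>p<Suc n. \<integral>\<^sup>+\<omega>. ennreal ((g (real p * s / ?N) \<omega>)\<^sup>2) \<partial>M)"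
        using gm by (subst nn_integral_cmult, (intro borel_measurable_sum measurable_compose[OF _ measurable_ennreal] borel_measurable_power; simp), subst nn_integral_sum) auto
      also have "\<dots> \<le> ennreal (s\<^sup>2 / ?N) * (\<Sum>p<Suc n. ennreal C)"
        using node C by (intro mult_left_mono sum_mono) auto
      also have "\<dots> = ennreal (s\<^sup>2 / ?N) * ennreal (?N * C)"
        using C0 by (subst sum_ennreal) auto
      also have "\<dots> = ennreal (s\<^sup>2 * C)"
        using C0 by (subst ennreal_mult[symmetric]) auto
      also have "\<dots> \<le> ennreal (T\<^sup>2 * C)"
        using C0 s by (intro ennreal_leI mult_right_mono power_mono) auto
      finally show ?thesis .
    qed
    have lim: "AE \<omega> in M. ennreal ((Z s \<omega>)\<^sup>2) = liminf (\<lambda>n. ennreal ((R n \<omega>)\<^sup>2))"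
      using cont int
    proof eventually_elim
      case (elim \<omega>)
      have "(\<lambda>n. R n \<omega>) \<longlonglongrightarrow> Z s \<omega>"
        unfolding R_def
        by (rule riemann_sums_converge) (use elim s in \<open>auto intro: continuous_on_subset\<close>)
      then have "(\<lambda>n. ennreal ((R n \<omega>)\<^sup>2)) \<longlonglongrightarrow> ennreal ((Z s \<omega>)\<^sup>2)"
        by (intro tendsto_ennrealI tendsto_power)
      then show ?case
        using lim_imp_Liminf[OF sequentially_bot] by metis
    qed
    have "(\<integral>\<^sup>+\<omega>. ennreal ((Z s \<omega>)\<^sup>2) \<partial>M) = (\<integral>\<^sup>+\<omega>. liminf (\<lambda>n. ennreal ((R n \<omega>)\<^sup>2)) \<partial>M)"
      by (rule nn_integral_cong_AE[OF lim])
    also have "\<dots> \<le> liminf (\<lambda>n. \<integral>\<^sup>+\<omega>. ennreal ((R n \<omega>)\<^sup>2) \<partial>M)"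
      by (rule nn_integral_liminf) measurable
    also have "\<dots> \<le> liminf (\<lambda>n. ennreal (T\<^sup>2 * C))"
      by (rule Liminf_mono) (simp add: Rb)
    also have "\<dots> = ennreal (T\<^sup>2 * C)" by (simp add: Liminf_const)
    finally show "(\<integral>\<^sup>+\<omega>. ennreal ((Z s \<omega>)\<^sup>2) \<partial>M) \<le> ennreal (T\<^sup>2 * C)" .
  qed
qed (rule meas)

text \<open>
  The second moment of the increment is \<open>s\<close>, so it is bounded by the horizon \<open>T\<close>.
\<close>
lemma cont_L2_process_brownian:
  assumes W: "std_brownian_motion M n W" and i: "i < n"
  shows "cont_L2_process M T (\<lambda>s \<omega>. W s \<omega> i - W 0 \<omega> i)"
proof -
  interpret prob_space M using W by (simp add: std_brownian_motion_def)
  have meas: "(\<lambda>\<omega>. W s \<omega> i) \<in> borel_measurable M" if "s \<ge> 0" for s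
    using W i that by (simp add: std_brownian_motion_def)
  have var: "(\<integral>\<^sup>+\<omega>. ennreal ((W s \<omega> i - W 0 \<omega> i)\<^sup>2) \<partial>M) \<le> ennreal T" if s: "s \<in> {0..T}" for s
  proof (cases "s = 0")
    case False
    with s have s0: "s > 0" by simp
    have D: "distributed M lborel (\<lambda>\<omega>. W s \<omega> i - W 0 \<omega> i) (normal_density 0 (sqrt s))"
      using W i s0 unfolding std_brownian_motion_def
      by (elim conjE, drule_tac x = 0 in spec, drule_tac x = s in spec) simp
    have "variance (\<lambda>\<omega>. W s \<omega> i - W 0 \<omega> i) = s"
      using normal_distributed_variance[OF _ D] s0 by simp
    moreover have "expectation (\<lambda>\<omega>. W s \<omega> i - W 0 \<omega> i) = 0"
      using normal_distributed_expectation[OF _ D] s0 by simp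
    ultimately have E: "expectation (\<lambda>\<omega>. (W s \<omega> i - W 0 \<omega> i)\<^sup>2) = s" by simp
    then have "integrable M (\<lambda>\<omega>. (W s \<omega> i - W 0 \<omega> i)\<^sup>2)"
      using s0 not_integrable_integral_eq by fastforce
    then have "(\<integral>\<^sup>+\<omega>. ennreal ((W s \<omega> i - W 0 \<omega> i)\<^sup>2) \<partial>M) = ennreal s"
      using E by (subst nn_integral_eq_integral) auto
    with s show ?thesis by (simp add: ennreal_leI)
  qed simp
  have "AE \<omega> in M. continuous_on {0..T} (\<lambda>s. W s \<omega> i - W 0 \<omega> i)"
  proof -
    have "AE \<omega> in M. \<forall>i<n. W 0 \<omega> i = 0 \<and> continuous_on {0..} (\<lambda>t. W t \<omega> i)"
      using W by (simp add: std_brownian_motion_def)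
    then show ?thesis
      by eventually_elim (intro continuous_intros, rule continuous_on_subset[of "{0..}"], use i in auto)
  qed
  moreover have "(\<lambda>\<omega>. W s \<omega> i - W 0 \<omega> i) \<in> borel_measurable M" if "s \<in> {0..T}" for s
    using that by (intro borel_measurable_diff meas) auto
  ultimately show ?thesis
    using var unfolding cont_L2_process_def by blast
qed

section \<open>Solutions of the linear system\<close>

lemma index_transpose_mult_block:
  assumes "A \<in> carrier_mat (m (k - 1)) n" "l < n"
  shows "(transpose_mat A *\<^sub>v block m y k) $ l = (\<Sum>p<m (k - 1). A $$ (p, l) * y k p)"
  using assms by (auto simp: block_def scalar_prod_def atLeast0LessThan intro!: sum.cong)

text \<open>
  Induction on the block: the first one is a linear combination of Brownian coordinates, and each
  later one is a time integral of the one before it.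
\<close>
lemma solution_cont_L2:
  assumes W: "std_brownian_motion M (m 0) W" and sol: "solves_sde M r m \<sigma> B W x X"
    and \<sigma>: "\<sigma> \<in> carrier_mat (m 0) (m 0)"
    and B: "\<And>k. k \<in> {1..r} \<Longrightarrow> B k \<in> carrier_mat (m (k - 1)) (m k)"
    and c: "(k, j) \<in> coords r m"
  shows "cont_L2_process M T (\<lambda>s \<omega>. X s \<omega> k j)"
proof -
  have P: "prob_space M" using W by (simp add: std_brownian_motion_def)
  have meas: "(\<lambda>\<omega>. X s \<omega> k j) \<in> borel_measurable M" if "s \<ge> 0" "(k, j) \<in> coords r m" for s k j
    by (rule measurable_compose[OF _ measurable_state_coordinate[OF that(2)]])
      (use sol that in \<open>simp add: solves_sde_def\<close>)
  have paths: "AE \<omega> in M. \<forall>t\<ge>0.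
        (\<forall>j<m 0. X t \<omega> 1 j =
           x 1 j + (\<sigma> *\<^sub>v Matrix.vec (m 0) (\<lambda>i. W t \<omega> i - W 0 \<omega> i)) $ j) \<and>
        (\<forall>k\<in>{1..r}. \<forall>j<m k.
           ((\<lambda>s. (transpose_mat (B k) *\<^sub>v block m (X s \<omega>) k) $ j)
              has_integral (X t \<omega> (k + 1) j - x (k + 1) j)) {0..t})"
    using sol by (simp add: solves_sde_def)
  have "1 \<le> k" using c by (simp add: coords_def)
  then show ?thesis
    using c
  proof (induction k arbitrary: j rule: dec_induct)
    case base
    then have j: "j < m 0" by (simp add: coords_def)
    have "cont_L2_process M T (\<lambda>s \<omega>. x 1 j + (\<Sum>i<m 0. \<sigma> $$ (j, i) * (W s \<omega> i - W 0 \<omega> i)))"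
      by (intro cont_L2_process_add cont_L2_process_const P cont_L2_process_linear_combination
          cont_L2_process_brownian[OF W]) auto
    then show ?case
    proof (rule cont_L2_process_modification)
      show "AE \<omega> in M. \<forall>s\<in>{0..T}.
          X s \<omega> 1 j = x 1 j + (\<Sum>i<m 0. \<sigma> $$ (j, i) * (W s \<omega> i - W 0 \<omega> i))"
        using paths
        by eventually_elim (use j \<sigma> in \<open>auto simp: scalar_prod_def atLeast0LessThan\<close>)
    qed (use meas base in auto)
  next
    case (step k)
    then have k: "k \<in> {1..r}" and j: "j < m k" by (auto simp: coords_def)
    let ?Z = "\<lambda>s \<omega>. X s \<omega> (Suc k) j - x (Suc k) j"
    have "cont_L2_process M T ?Z"
    proof (rule cont_L2_process_time_integral)
      show "cont_L2_process M T (\<lambda>s \<omega>. \<Sum>p<m (k - 1). B k $$ (p, j) * X s \<omega> k p)"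
        by (rule cont_L2_process_linear_combination) (use k step.IH in \<open>auto simp: coords_def\<close>)
      show "?Z s \<in> borel_measurable M" if "s \<in> {0..T}" for s
        using that step.prems by (intro borel_measurable_diff meas) auto
      show "AE \<omega> in M. \<forall>s\<in>{0..T}.
          ((\<lambda>u. \<Sum>p<m (k - 1). B k $$ (p, j) * X u \<omega> k p) has_integral ?Z s \<omega>) {0..s}"
        using paths
      proof eventually_elim
        case (elim \<omega>)
        then show ?case
          using k j unfolding index_transpose_mult_block[where m = m and k = k, OF B[OF k] j, symmetric]
          by auto
      qed
    qed
    from cont_L2_process_add[OF this cont_L2_process_const[OF P, of T "x (Suc k) j"]]
    show ?case by simp
  qed
qed

lemma solution_l1_dist_square_integrable:
  assumes W: "std_brownian_motion M (m 0) W" and sol: "solves_sde M r m \<sigma> B W x X"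
    and \<sigma>: "\<sigma> \<in> carrier_mat (m 0) (m 0)"
    and B: "\<And>k. k \<in> {1..r} \<Longrightarrow> B k \<in> carrier_mat (m (k - 1)) (m k)"
    and t: "0 \<le> t"
  shows "integrable M (\<lambda>\<omega>. (l1_dist r m z (X t \<omega>))\<^sup>2)"
proof -
  have P: "prob_space M" using W by (simp add: std_brownian_motion_def)
  have Xt: "X t \<in> measurable M (state_borel r m)" using sol t by (simp add: solves_sde_def)
  have sq: "integrable M (\<lambda>\<omega>. (X t \<omega> k j - z k j)\<^sup>2)" if "(k, j) \<in> coords r m" for k j
    using cont_L2_process_integrable_square[OF cont_L2_process_add[OF
        solution_cont_L2[OF W sol \<sigma> B that] cont_L2_process_const[OF P, of t "- z k j"]], of t] t
    by simp
  show ?thesis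
  proof (rule Bochner_Integration.integrable_bound)
    show "integrable M (\<lambda>\<omega>. (\<Sum>(k, j)\<in>coords r m. (X t \<omega> k j - z k j)\<^sup>2) * real (card (coords r m)))"
      by (intro integrable_mult_left) (auto intro!: Bochner_Integration.integrable_sum sq)
    have "(\<lambda>\<omega>. X t \<omega> k j) \<in> borel_measurable M" if "(k, j) \<in> coords r m" for k j
      by (rule measurable_compose[OF Xt measurable_state_coordinate[OF that]])
    then show "(\<lambda>\<omega>. (l1_dist r m z (X t \<omega>))\<^sup>2) \<in> borel_measurable M"
      unfolding l1_dist_def
      by (intro borel_measurable_power borel_measurable_sum) (auto simp: case_prod_beta)
    show "AE \<omega> in M. norm ((l1_dist r m z (X t \<omega>))\<^sup>2)
        \<le> norm ((\<Sum>(k, j)\<in>coords r m. (X t \<omega> k j - z k j)\<^sup>2) * real (card (coords r m)))"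
    proof (intro AE_I2)
      fix \<omega>
      have "(l1_dist r m z (X t \<omega>))\<^sup>2
          \<le> (\<Sum>(k, j)\<in>coords r m. (X t \<omega> k j - z k j)\<^sup>2) * real (card (coords r m))"
        using sum_squared_le_sum_of_squares[of "\<lambda>(k, j). \<bar>X t \<omega> k j - z k j\<bar>" "coords r m"]
        by (simp add: l1_dist_def case_prod_beta)
      then show "norm ((l1_dist r m z (X t \<omega>))\<^sup>2)
        \<le> norm ((\<Sum>(k, j)\<in>coords r m. (X t \<omega> k j - z k j)\<^sup>2) * real (card (coords r m)))"
        by simp
    qed
  qed
qed

lemma integrable_of_quadratic_growth:
  assumes M: "prob_space M" and Z: "Z \<in> measurable M (state_borel r m)"
    and sq: "integrable M (\<lambda>\<omega>. (l1_dist r m x (Z \<omega>))\<^sup>2)"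
    and g: "g \<in> borel_measurable (state_borel r m)"
    and growth: "\<And>y. y \<in> state_space r m \<Longrightarrow> \<bar>g y\<bar> \<le> a + b * (l1_dist r m x y)\<^sup>2"
  shows "integrable M (\<lambda>\<omega>. g (Z \<omega>))"
proof (rule Bochner_Integration.integrable_bound)
  interpret prob_space M by fact
  show "integrable M (\<lambda>\<omega>. a + b * (l1_dist r m x (Z \<omega>))\<^sup>2)"
    using sq by simp
  show "(\<lambda>\<omega>. g (Z \<omega>)) \<in> borel_measurable M"
    by (rule measurable_compose[OF Z g])
  have "Z \<omega> \<in> state_space r m" if "\<omega> \<in> space M" for \<omega>
    using measurable_space[OF Z that] by (simp add: space_state_borel)
  then show "AE \<omega> in M. norm (g (Z \<omega>)) \<le> norm (a + b * (l1_dist r m x (Z \<omega>))\<^sup>2)"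
    by (intro AE_I2) (simp add: order_trans[OF growth abs_ge_self])
qed

text \<open>
  Square integrability is what makes the right-hand side of the gradient bound a genuine
  expectation: the Bochner integral of a non-integrable function is 0.
\<close>
lemma solution_partial_deriv_integrable:
  assumes W: "std_brownian_motion M (m 0) W" and sol: "solves_sde M r m \<sigma> B W x X"
    and \<sigma>: "\<sigma> \<in> carrier_mat (m 0) (m 0)"
    and B: "\<And>k. k \<in> {1..r} \<Longrightarrow> B k \<in> carrier_mat (m (k - 1)) (m k)"
    and C2: "C_k r m 2 f" and bd: "bounded_second_derivs r m f"
    and t: "0 \<le> t" and x: "x \<in> state_space r m" and kl: "(k, l) \<in> coords r m"
  shows "integrable M (\<lambda>\<omega>. partial_deriv k l f (X t \<omega>))"
    and "integrable M (\<lambda>\<omega>. (partial_deriv k l f (X t \<omega>))\<^sup>2)"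
proof -
  have P: "prob_space M" using W by (simp add: std_brownian_motion_def)
  interpret prob_space M by fact
  have Xm: "X t \<in> measurable M (state_borel r m)"
    using sol t by (simp add: solves_sde_def)
  obtain a b where
    "\<And>y. y \<in> state_space r m \<Longrightarrow> \<bar>(partial_deriv k l f y)\<^sup>2\<bar> \<le> a + b * (l1_dist r m x y)\<^sup>2"
    using partial_deriv_square_growth[OF C2 bd x kl] by blast
  from integrable_of_quadratic_growth[OF P Xm
      solution_l1_dist_square_integrable[OF W sol \<sigma> B t]
      borel_measurable_power[OF C_2_measurable(2)[OF C2 kl]] this]
  show sq: "integrable M (\<lambda>\<omega>. (partial_deriv k l f (X t \<omega>))\<^sup>2)" .
  show "integrable M (\<lambda>\<omega>. partial_deriv k l f (X t \<omega>))"
    by (rule square_integrable_imp_integrable[OF measurable_compose[OF Xm C_2_measurable(2)[OF C2 kl]] sq])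
qed

text \<open>
  The entry in row \<open>j\<close> and column \<open>l\<close> of the product \<open>B\<^sub>i B\<^sub>i\<^sub>+\<^sub>1 \<dots> B\<^sub>i\<^sub>+\<^sub>d\<^sub>-\<^sub>1\<close>, whose partial products
  have \<open>m (i + d - 1)\<close> columns.
\<close>
primrec chain_entry :: "(nat \<Rightarrow> nat) \<Rightarrow> (nat \<Rightarrow> real mat) \<Rightarrow> nat \<Rightarrow> nat \<Rightarrow> nat \<Rightarrow> nat \<Rightarrow> real" where
  "chain_entry m B i j 0 l = (if l = j then 1 else 0)"
| "chain_entry m B i j (Suc d) l =
     (\<Sum>p<m (i + d - 1). B (i + d) $$ (p, l) * chain_entry m B i j d p)"

text \<open>
  The derivative of coordinate \<open>l\<close> of block \<open>k\<close> at time \<open>t\<close> with respect to the initial value of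
  coordinate \<open>j\<close> of block \<open>i\<close>.
\<close>
definition flow_entry ::
  "(nat \<Rightarrow> nat) \<Rightarrow> (nat \<Rightarrow> real mat) \<Rightarrow> real \<Rightarrow> nat \<Rightarrow> nat \<Rightarrow> nat \<Rightarrow> nat \<Rightarrow> real" where
  "flow_entry m B t i j k l =
     (if k < i then 0 else t ^ (k - i) / fact (k - i) * chain_entry m B i j (k - i) l)"

text \<open>
  The difference \<open>u\<close> of two solutions satisfies the equation without noise, which is triangular:
  each block is determined by the one before it. A shift by \<open>h\<close> enters at block \<open>i\<close>, and every further
  block multiplies by the next matrix and integrates \<open>\<tau>\<^sup>d / d!\<close> to the next power.
\<close>
lemma flow_entry_unique:
  fixes u :: "real \<Rightarrow> point"
  assumes first: "\<And>s l. 0 \<le> s \<Longrightarrow> l < m 0 \<Longrightarrow> u s 1 l = (if (1, l) = (i, j) then h else 0)"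
    and later: "\<And>s k l. 0 \<le> s \<Longrightarrow> k \<in> {1..r} \<Longrightarrow> l < m k \<Longrightarrow>
      ((\<lambda>\<tau>. \<Sum>p<m (k - 1). B k $$ (p, l) * u \<tau> k p) has_integral
        (u s (Suc k) l - (if (Suc k, l) = (i, j) then h else 0))) {0..s}"
    and i: "1 \<le> i" and c: "(k, l) \<in> coords r m" and s: "0 \<le> s"
  shows "u s k l = h * flow_entry m B s i j k l"
proof -
  have "1 \<le> k" using c by (simp add: coords_def)
  then show ?thesis
    using c s
  proof (induction k arbitrary: l s rule: dec_induct)
    case base
    with i show ?case
      using first[of s l] by (auto simp: flow_entry_def coords_def)
  next
    case (step k)
    then have k: "k \<in> {1..r}" and l: "l < m k" by (auto simp: coords_def)
    let ?w = "\<lambda>\<tau>. \<Sum>p<m (k - 1). B k $$ (p, l) * (h * flow_entry m B \<tau> i j k p)"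
    have "(?w has_integral (u s (Suc k) l - (if (Suc k, l) = (i, j) then h else 0))) {0..s}"
    proof (rule has_integral_eq[OF _ later[OF step.prems(2) k l]])
      fix \<tau> assume "\<tau> \<in> {0..s}"
      then show "(\<Sum>p<m (k - 1). B k $$ (p, l) * u \<tau> k p) = ?w \<tau>"
        using step.IH k by (intro sum.cong) (auto simp: coords_def)
    qed
    moreover have "(?w has_integral (h * flow_entry m B s i j (Suc k) l
        - (if (Suc k, l) = (i, j) then h else 0))) {0..s}"
    proof (cases "k < i")
      case True
      then show ?thesis by (auto simp: flow_entry_def)
    next
      case False
      define d where "d = k - i"
      have kd: "k = i + d" using False by (simp add: d_def)
      let ?q = "chain_entry m B i j (Suc d) l"
      have w: "?w \<tau> = h * ?q * (\<tau> ^ d / fact d)" for \<tau>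
        by (simp add: flow_entry_def kd sum_distrib_left sum_distrib_right mult_ac)
      have "((\<lambda>\<tau>. h * ?q * (\<tau> ^ d / fact d)) has_integral
          (h * ?q * (s ^ Suc d / fact (Suc d)) - h * ?q * (0 ^ Suc d / fact (Suc d)))) {0..s}"
      proof (rule fundamental_theorem_of_calculus[OF step.prems(2)])
        fix \<tau> :: real
        have "((\<lambda>\<tau>. \<tau> ^ Suc d / fact (Suc d)) has_real_derivative
            real (Suc d) * \<tau> ^ d / fact (Suc d)) (at \<tau> within {0..s})"
          using DERIV_cdivide[OF DERIV_pow[of "Suc d" \<tau> "{0..s}"], of "fact (Suc d)"] by simp
        also have "real (Suc d) * \<tau> ^ d / fact (Suc d) = \<tau> ^ d / fact d"
          by (simp only: fact_Suc) (simp del: of_nat_Suc)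
        finally show "((\<lambda>\<tau>. h * ?q * (\<tau> ^ Suc d / fact (Suc d))) has_vector_derivative
            h * ?q * (\<tau> ^ d / fact d)) (at \<tau> within {0..s})"
          by (intro DERIV_cmult has_real_derivative_iff_has_vector_derivative[THEN iffD1])
      qed
      moreover have "h * flow_entry m B s i j (Suc k) l = h * ?q * (s ^ Suc d / fact (Suc d))"
        unfolding flow_entry_def kd by (simp add: Suc_diff_le del: chain_entry.simps)
      ultimately show ?thesis
        unfolding w using False by (simp del: chain_entry.simps)
    qed
    ultimately show ?case
      by (auto dest: has_integral_unique)
  qed
qed

text \<open>
  The noise term is the same for both solutions and cancels in the difference of the first blocks.
\<close>
lemma solution_depends_affinely_on_start:
  assumes sol: "solves_sde M r m \<sigma> B W x X"
    and sol': "solves_sde M r m \<sigma> B W (x(i := (x i)(j := s))) Y"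
    and B: "\<And>k. k \<in> {1..r} \<Longrightarrow> B k \<in> carrier_mat (m (k - 1)) (m k)"
    and i: "1 \<le> i" and t: "0 \<le> t"
  shows "AE \<omega> in M. \<forall>(k, l)\<in>coords r m.
    Y t \<omega> k l = X t \<omega> k l + (s - x i j) * flow_entry m B t i j k l"
proof -
  let ?y = "x(i := (x i)(j := s))" and ?h = "s - x i j"
  have "AE \<omega> in M. \<forall>t\<ge>0.
        (\<forall>j<m 0. X t \<omega> 1 j =
           x 1 j + (\<sigma> *\<^sub>v Matrix.vec (m 0) (\<lambda>i. W t \<omega> i - W 0 \<omega> i)) $ j) \<and>
        (\<forall>k\<in>{1..r}. \<forall>j<m k.
           ((\<lambda>s. (transpose_mat (B k) *\<^sub>v block m (X s \<omega>) k) $ j)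
              has_integral (X t \<omega> (k + 1) j - x (k + 1) j)) {0..t})"
    using sol by (simp add: solves_sde_def)
  moreover have "AE \<omega> in M. \<forall>t\<ge>0.
        (\<forall>j<m 0. Y t \<omega> 1 j =
           ?y 1 j + (\<sigma> *\<^sub>v Matrix.vec (m 0) (\<lambda>i. W t \<omega> i - W 0 \<omega> i)) $ j) \<and>
        (\<forall>k\<in>{1..r}. \<forall>j<m k.
           ((\<lambda>s. (transpose_mat (B k) *\<^sub>v block m (Y s \<omega>) k) $ j)
              has_integral (Y t \<omega> (k + 1) j - ?y (k + 1) j)) {0..t})"
    using sol' by (simp only: solves_sde_def)
  ultimately show ?thesis
  proof eventually_elim
    case (elim \<omega>)
    define u where "u t k l = Y t \<omega> k l - X t \<omega> k l" for t k l
    have start: "?y k l - x k l = (if (k, l) = (i, j) then ?h else 0)" for k l by auto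
    have "u t k l = ?h * flow_entry m B t i j k l" if c: "(k, l) \<in> coords r m" for k l
    proof (rule flow_entry_unique[where r = r, OF _ _ i c t])
      fix s :: real and l assume "0 \<le> s" "l < m 0"
      then show "u s 1 l = (if (1, l) = (i, j) then ?h else 0)"
        using elim start[of 1 l] by (simp add: u_def)
    next
      fix s :: real and k l assume s: "0 \<le> s" and k: "k \<in> {1..r}" and l: "l < m k"
      have "((\<lambda>s. \<Sum>p<m (k - 1). B k $$ (p, l) * Y s \<omega> k p)
            has_integral (Y s \<omega> (k + 1) l - ?y (k + 1) l)) {0..s}"
        using elim(2) s k l unfolding index_transpose_mult_block[where m = m and k = k, OF B[OF k] l, symmetric] by blast
      moreover have "((\<lambda>s. \<Sum>p<m (k - 1). B k $$ (p, l) * X s \<omega> k p)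
            has_integral (X s \<omega> (k + 1) l - x (k + 1) l)) {0..s}"
        using elim(1) s k l unfolding index_transpose_mult_block[where m = m and k = k, OF B[OF k] l, symmetric] by blast
      ultimately have "((\<lambda>s. (\<Sum>p<m (k - 1). B k $$ (p, l) * Y s \<omega> k p)
            - (\<Sum>p<m (k - 1). B k $$ (p, l) * X s \<omega> k p)) has_integral
          ((Y s \<omega> (k + 1) l - ?y (k + 1) l) - (X s \<omega> (k + 1) l - x (k + 1) l))) {0..s}"
        by (rule has_integral_diff)
      moreover have "(Y s \<omega> (k + 1) l - ?y (k + 1) l) - (X s \<omega> (k + 1) l - x (k + 1) l)
          = u s (Suc k) l - (if (Suc k, l) = (i, j) then ?h else 0)"
        using start[of "Suc k" l] by (simp add: u_def)
      ultimately have "((\<lambda>s. (\<Sum>p<m (k - 1). B k $$ (p, l) * Y s \<omega> k p)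
            - (\<Sum>p<m (k - 1). B k $$ (p, l) * X s \<omega> k p)) has_integral
          (u s (Suc k) l - (if (Suc k, l) = (i, j) then ?h else 0))) {0..s}"
        by (simp only:)
      then show "((\<lambda>\<tau>. \<Sum>p<m (k - 1). B k $$ (p, l) * u \<tau> k p) has_integral
          (u s (Suc k) l - (if (Suc k, l) = (i, j) then ?h else 0))) {0..s}"
        by (simp only: u_def sum_subtractf right_diff_distrib)
    qed
    then show ?case by (auto simp: u_def algebra_simps)
  qed
qed

section \<open>The gradient of the semigroup\<close>

lemma quadratic_remainder_DERIV:
  fixes F :: "real \<Rightarrow> real"
  assumes "\<And>s. \<bar>F s - F a - (s - a) * D\<bar> \<le> K * (s - a)\<^sup>2"
  shows "(F has_real_derivative D) (at a)"
  unfolding has_field_derivative_iff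
proof (rule LIM_I)
  fix e :: real assume e: "e > 0"
  define K' where "K' = \<bar>K\<bar> + 1"
  have K': "K' > 0" "K \<le> K'" by (auto simp: K'_def)
  show "\<exists>d>0. \<forall>s. s \<noteq> a \<and> norm (s - a) < d \<longrightarrow> norm ((F s - F a) / (s - a) - D) < e"
  proof (intro exI[of _ "e / K'"] conjI allI impI)
    fix s assume s: "s \<noteq> a \<and> norm (s - a) < e / K'"
    then have "(F s - F a) / (s - a) - D = (F s - F a - (s - a) * D) / (s - a)"
      by (simp add: field_simps)
    then have "norm ((F s - F a) / (s - a) - D) = \<bar>F s - F a - (s - a) * D\<bar> / \<bar>s - a\<bar>"
      by (simp add: abs_divide)
    also have "\<dots> \<le> (K' * (s - a)\<^sup>2) / \<bar>s - a\<bar>"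
      by (intro divide_right_mono order_trans[OF assms mult_right_mono[OF K'(2)]]) simp_all
    also have "\<dots> = K' * \<bar>s - a\<bar>"
      using s unfolding power2_abs[of "s - a", symmetric]
      by (simp add: power2_eq_square del: abs_mult_self_eq)
    also have "\<dots> < e" using s K'(1) by (simp add: field_simps)
    finally show "norm ((F s - F a) / (s - a) - D) < e" .
  qed (use e K' in simp)
qed

text \<open>
  Differentiation under the expectation. Moving the start by \<open>h\<close> along a coordinate moves the solution
  by \<open>h\<close> times a deterministic vector, so the Taylor remainder is at most \<open>K N\<^sup>2 h\<^sup>2\<close> almost surely,
  with \<open>N\<close> the \<open>\<ell>\<^sup>1\<close> norm of that vector, and so is its expectation.
\<close>
lemma semigroup_partial_deriv:
  assumes W: "std_brownian_motion M (m 0) W"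
    and sol: "\<And>y. y \<in> state_space r m \<Longrightarrow> solves_sde M r m \<sigma> B W y (X y)"
    and \<sigma>: "\<sigma> \<in> carrier_mat (m 0) (m 0)"
    and B: "\<And>k. k \<in> {1..r} \<Longrightarrow> B k \<in> carrier_mat (m (k - 1)) (m k)"
    and C2: "C_k r m 2 f" and bd: "bounded_second_derivs r m f"
    and t: "0 \<le> t" and x: "x \<in> state_space r m" and c: "(i, j) \<in> coords r m"
  shows "partial_deriv i j (semigroup_of M X t f) x =
    (\<Sum>(k, l)\<in>coords r m. flow_entry m B t i j k l * (\<integral>\<omega>. partial_deriv k l f (X x t \<omega>) \<partial>M))"
proof -
  have P: "prob_space M" using W by (simp add: std_brownian_motion_def)
  interpret prob_space M by fact
  obtain K where K: "K \<ge> 0"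
    "\<And>k j p q z. (k, j) \<in> coords r m \<Longrightarrow> (p, q) \<in> coords r m \<Longrightarrow> z \<in> state_space r m \<Longrightarrow>
       \<bar>partial_deriv k j (partial_deriv p q f) z\<bar> \<le> K"
    using second_derivs_uniform_bound[OF bd] by blast
  have Xm: "X y t \<in> measurable M (state_borel r m)" if "y \<in> state_space r m" for y
    using sol[OF that] t by (simp add: solves_sde_def)
  have XS: "X y t \<omega> \<in> state_space r m" if "y \<in> state_space r m" "\<omega> \<in> space M" for y \<omega>
    using measurable_space[OF Xm[OF that(1)] that(2)] by (simp add: space_state_borel)
  have fint: "integrable M (\<lambda>\<omega>. f (X y t \<omega>))" if y: "y \<in> state_space r m" for y
  proof -
    obtain a b where "\<And>y. y \<in> state_space r m \<Longrightarrow> \<bar>f y\<bar> \<le> a + b * (l1_dist r m x y)\<^sup>2"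
      using quadratic_growth[OF C2 bd x] by blast
    from integrable_of_quadratic_growth[OF P Xm[OF y]
        solution_l1_dist_square_integrable[OF W sol[OF y] \<sigma> B t] C_2_measurable(1)[OF C2] this]
    show ?thesis .
  qed
  have dint: "integrable M (\<lambda>\<omega>. partial_deriv k l f (X x t \<omega>))" if "(k, l) \<in> coords r m" for k l
    by (rule solution_partial_deriv_integrable(1)[OF W sol[OF x] \<sigma> B C2 bd t x that])
  let ?v = "flow_entry m B t i j"
  let ?F = "coord_line (semigroup_of M X t f) i j x"
  let ?D = "\<Sum>(k, l)\<in>coords r m. ?v k l * (\<integral>\<omega>. partial_deriv k l f (X x t \<omega>) \<partial>M)"
  define N where "N = (\<Sum>(k, l)\<in>coords r m. \<bar>?v k l\<bar>)"
  have "(?F has_real_derivative ?D) (at (x i j))"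
  proof (rule quadratic_remainder_DERIV)
    fix s
    let ?y = "x(i := (x i)(j := s))" and ?h = "s - x i j"
    have y: "?y \<in> state_space r m" by (rule state_space_update[OF x c])
    let ?R = "\<lambda>\<omega>. f (X ?y t \<omega>) - f (X x t \<omega>)
        - (\<Sum>(k, l)\<in>coords r m. partial_deriv k l f (X x t \<omega>) * (?h * ?v k l))"
    let ?S = "\<lambda>\<omega>. \<Sum>(k, l)\<in>coords r m. partial_deriv k l f (X x t \<omega>) * (?h * ?v k l)"
    have Sint: "integrable M ?S"
      unfolding case_prod_beta
      by (intro Bochner_Integration.integrable_sum integrable_mult_left dint) simp
    have Rint: "integrable M ?R"
      by (intro Bochner_Integration.integrable_diff fint x y Sint)
    have ES: "expectation ?S = ?h * ?D"
    proof -
      have "expectation ?S = (\<Sum>c\<in>coords r m.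
          expectation (\<lambda>\<omega>. partial_deriv (fst c) (snd c) f (X x t \<omega>) * (?h * ?v (fst c) (snd c))))"
        unfolding case_prod_beta
        by (intro Bochner_Integration.integral_sum integrable_mult_left dint) simp
      also have "\<dots> = ?h * ?D"
        unfolding sum_distrib_left case_prod_beta integral_mult_left_zero
        by (rule sum.cong[OF refl]) (simp only: mult_ac)
      finally show ?thesis .
    qed
    have ER: "expectation ?R = ?F s - ?F (x i j) - ?h * ?D"
      unfolding Bochner_Integration.integral_diff[OF
          Bochner_Integration.integrable_diff[OF fint[OF y] fint[OF x]] Sint]
        Bochner_Integration.integral_diff[OF fint[OF y] fint[OF x]] ES
      by (simp only: coord_line_def semigroup_of_def fun_upd_triv)
    have "1 \<le> i" using c by (simp add: coords_def)
    have "AE \<omega> in M. \<forall>(k, l)\<in>coords r m. X ?y t \<omega> k l = X x t \<omega> k l + ?h * ?v k l"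
      by (rule solution_depends_affinely_on_start[OF sol[OF x] sol[OF y] B \<open>1 \<le> i\<close> t])
    then have "AE \<omega> in M. \<bar>?R \<omega>\<bar> \<le> K * (\<bar>?h\<bar> * N)\<^sup>2"
      using AE_space
    proof eventually_elim
      case (elim \<omega>)
      have "l1_dist r m (X x t \<omega>) (X ?y t \<omega>) = \<bar>?h\<bar> * N"
        unfolding l1_dist_def N_def sum_distrib_left
        by (rule sum.cong) (use elim(1) in \<open>auto simp: abs_mult\<close>)
      moreover have "(\<Sum>(k, l)\<in>coords r m. partial_deriv k l f (X x t \<omega>) * (?h * ?v k l))
          = (\<Sum>(k, l)\<in>coords r m. partial_deriv k l f (X x t \<omega>) * (X ?y t \<omega> k l - X x t \<omega> k l))"
        by (rule sum.cong) (use elim(1) in auto)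
      ultimately show ?case
        using taylor_remainder_bound[OF C2 K(2,1) XS[OF x elim(2)] XS[OF y elim(2)]] by simp
    qed
    then have "expectation (\<lambda>\<omega>. \<bar>?R \<omega>\<bar>) \<le> K * (\<bar>?h\<bar> * N)\<^sup>2"
      by (rule integral_le_const[OF integrable_abs[OF Rint]])
    then have "\<bar>expectation ?R\<bar> \<le> K * (\<bar>?h\<bar> * N)\<^sup>2"
      using integral_abs_bound[of M ?R] by linarith
    then show "\<bar>?F s - ?F (x i j) - ?h * ?D\<bar> \<le> (K * N\<^sup>2) * ?h\<^sup>2"
      unfolding ER by (simp add: power_mult_distrib mult_ac)
  qed
  then show ?thesis unfolding partial_deriv_def by (rule DERIV_imp_deriv)
qed

section \<open>Weighted gradients and the gradient bound\<close>

lemma ordered_prod_carrier: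
  assumes B: "\<And>k. k \<in> {1..r} \<Longrightarrow> B k \<in> carrier_mat (m (k - 1)) (m k)" and "k \<le> r"
  shows "ordered_prod m B k \<in> carrier_mat (m 0) (m k)"
  using assms(2)
proof (induction k)
  case (Suc k)
  then show ?case using B[of "Suc k"] by auto
qed simp

text \<open>
  Associativity, in the form \<open>(B\<^sub>1 \<dots> B\<^sub>i\<^sub>-\<^sub>1) (B\<^sub>i \<dots> B\<^sub>i\<^sub>+\<^sub>d\<^sub>-\<^sub>1) = B\<^sub>1 \<dots> B\<^sub>i\<^sub>+\<^sub>d\<^sub>-\<^sub>1\<close>, read entry by entry.
\<close>
lemma ordered_prod_chain_entry:
  assumes B: "\<And>k. k \<in> {1..r} \<Longrightarrow> B k \<in> carrier_mat (m (k - 1)) (m k)"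
    and i: "1 \<le> i" and k: "i + d \<le> r + 1" and l: "l < m (i + d - 1)" and a: "a < m 0"
  shows "(\<Sum>j<m (i - 1). ordered_prod m B (i - 1) $$ (a, j) * chain_entry m B i j d l)
    = ordered_prod m B (i + d - 1) $$ (a, l)"
  using k l
proof (induction d arbitrary: l)
  case 0
  then show ?case by (simp add: if_distrib[of "(*) _"] sum.delta cong: if_cong)
next
  case (Suc d)
  let ?n = "i + d - 1"
  have id: "i + Suc d - 1 = Suc ?n" "i + d = Suc ?n" using i by auto
  have Bk: "B (Suc ?n) \<in> carrier_mat (m ?n) (m (Suc ?n))" using B[of "Suc ?n"] Suc.prems i by simp
  have Pk: "ordered_prod m B ?n \<in> carrier_mat (m 0) (m ?n)"
    by (rule ordered_prod_carrier[where r = r]) (use B Suc.prems in auto)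
  have l: "l < m (Suc ?n)" using Suc.prems id by simp
  have "(\<Sum>j<m (i - 1). ordered_prod m B (i - 1) $$ (a, j) * chain_entry m B i j (Suc d) l)
      = (\<Sum>p<m ?n. (\<Sum>j<m (i - 1). ordered_prod m B (i - 1) $$ (a, j) * chain_entry m B i j d p)
          * B (Suc ?n) $$ (p, l))"
    using id by (subst sum_distrib_right, subst sum.swap) (simp add: sum_distrib_left mult_ac)
  also have "\<dots> = (\<Sum>p<m ?n. ordered_prod m B ?n $$ (a, p) * B (Suc ?n) $$ (p, l))"
    using Suc.IH Suc.prems by (intro sum.cong) auto
  also have "\<dots> = (ordered_prod m B ?n * B (Suc ?n)) $$ (a, l)"
    using Pk Bk a l by (auto simp: scalar_prod_def atLeast0LessThan intro!: sum.cong)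
  also have "\<dots> = ordered_prod m B (i + Suc d - 1) $$ (a, l)"
    unfolding id(1) by simp
  finally show ?case .
qed

lemma sum_coords: "(\<Sum>(k, l)\<in>coords r m. g k l) = (\<Sum>k=1..r+1. \<Sum>l<m (k - 1). g k l)"
  unfolding coords_def by (subst sum.Sigma) auto

text \<open>
  Here \<open>e k l\<close> stands for the expectation of a partial derivative of \<open>f\<close>. The products of matrices that
  reach block \<open>k\<close> do not depend on the block \<open>i\<close> where they enter, so the sum over \<open>i\<close> acts on
  scalars only; the substitution of \<open>k - i\<close> for \<open>i\<close> turns it into the weights of the theorem.
\<close>
lemma collect_gradient_weights:
  fixes e :: "nat \<Rightarrow> nat \<Rightarrow> real"
  assumes B: "\<And>k. k \<in> {1..r} \<Longrightarrow> B k \<in> carrier_mat (m (k - 1)) (m k)" and a: "a < m 0"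
  shows "(\<Sum>i=1..r+1. \<alpha> i * (\<Sum>j<m (i - 1). ordered_prod m B (i - 1) $$ (a, j)
        * (\<Sum>(k, l)\<in>coords r m. flow_entry m B t i j k l * e k l)))
    = (\<Sum>k=1..r+1. \<Sum>l<m (k - 1). ((\<Sum>i=0..k - 1. \<alpha> (k - i) * (t ^ i / fact i))
        * ordered_prod m B (k - 1) $$ (a, l)) * e k l)"
proof -
  let ?P = "ordered_prod m B"
  have flow: "(\<Sum>j<m (i - 1). ?P (i - 1) $$ (a, j) * flow_entry m B t i j k l)
      = (if k < i then 0 else t ^ (k - i) / fact (k - i) * ?P (k - 1) $$ (a, l))"
    if "i \<in> {1..r + 1}" "k \<in> {1..r + 1}" "l < m (k - 1)" for i k l
  proof (cases "k < i")
    case False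
    then have "(\<Sum>j<m (i - 1). ?P (i - 1) $$ (a, j) * flow_entry m B t i j k l)
        = t ^ (k - i) / fact (k - i)
          * (\<Sum>j<m (i - 1). ?P (i - 1) $$ (a, j) * chain_entry m B i j (k - i) l)"
      by (simp add: flow_entry_def sum_distrib_left mult_ac)
    also have "(\<Sum>j<m (i - 1). ?P (i - 1) $$ (a, j) * chain_entry m B i j (k - i) l)
        = ?P (k - 1) $$ (a, l)"
      using ordered_prod_chain_entry[where r = r and m = m and B = B and i = i and d = "k - i"
          and l = l and a = a, OF B] that a False by simp
    finally show ?thesis using False by simp
  qed (simp add: flow_entry_def)
  have reindex: "(\<Sum>i=1..r+1. \<alpha> i * (if k < i then 0 else t ^ (k - i) / fact (k - i)))
      = (\<Sum>i=0..k - 1. \<alpha> (k - i) * (t ^ i / fact i))" if k: "k \<in> {1..r + 1}" for k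
  proof -
    have "(\<Sum>i=1..r+1. \<alpha> i * (if k < i then 0 else t ^ (k - i) / fact (k - i)))
        = (\<Sum>i=1..k. \<alpha> i * (t ^ (k - i) / fact (k - i)))"
      using k by (intro sum.mono_neutral_cong_right) auto
    also have "\<dots> = (\<Sum>i=0..k - 1. \<alpha> (k - i) * (t ^ i / fact i))"
      by (rule sum.reindex_bij_witness[of _ "\<lambda>i. k - i" "\<lambda>i. k - i"]) (use k in auto)
    finally show ?thesis .
  qed
  have "(\<Sum>i=1..r+1. \<alpha> i * (\<Sum>j<m (i - 1). ?P (i - 1) $$ (a, j)
        * (\<Sum>(k, l)\<in>coords r m. flow_entry m B t i j k l * e k l)))
     = (\<Sum>i=1..r+1. \<Sum>(k, l)\<in>coords r m. \<alpha> i
        * (\<Sum>j<m (i - 1). ?P (i - 1) $$ (a, j) * flow_entry m B t i j k l) * e k l)"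
  proof (rule sum.cong[OF refl])
    fix i
    have "(\<Sum>j<m (i - 1). ?P (i - 1) $$ (a, j) * (\<Sum>(k, l)\<in>coords r m. flow_entry m B t i j k l * e k l))
        = (\<Sum>(k, l)\<in>coords r m. \<Sum>j<m (i - 1). ?P (i - 1) $$ (a, j) * (flow_entry m B t i j k l * e k l))"
      unfolding sum_distrib_left case_prod_beta by (rule sum.swap)
    then show "\<alpha> i * (\<Sum>j<m (i - 1). ?P (i - 1) $$ (a, j)
        * (\<Sum>(k, l)\<in>coords r m. flow_entry m B t i j k l * e k l))
      = (\<Sum>(k, l)\<in>coords r m. \<alpha> i
        * (\<Sum>j<m (i - 1). ?P (i - 1) $$ (a, j) * flow_entry m B t i j k l) * e k l)"
      by (simp add: sum_distrib_left sum_distrib_right case_prod_beta mult.assoc)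
  qed
  also have "\<dots> = (\<Sum>(k, l)\<in>coords r m. \<Sum>i=1..r+1. \<alpha> i
        * (\<Sum>j<m (i - 1). ?P (i - 1) $$ (a, j) * flow_entry m B t i j k l) * e k l)"
    unfolding case_prod_beta by (rule sum.swap)
  also have "\<dots> = (\<Sum>(k, l)\<in>coords r m. ((\<Sum>i=0..k - 1. \<alpha> (k - i) * (t ^ i / fact i))
        * ?P (k - 1) $$ (a, l)) * e k l)"
  proof (rule sum.cong[OF refl], clarify)
    fix k l assume "(k, l) \<in> coords r m"
    then have k: "k \<in> {1..r + 1}" and l: "l < m (k - 1)" by (auto simp: coords_def)
    have "(\<Sum>i=1..r+1. \<alpha> i
        * (\<Sum>j<m (i - 1). ?P (i - 1) $$ (a, j) * flow_entry m B t i j k l) * e k l)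
      = (\<Sum>i=1..r+1. \<alpha> i * (if k < i then 0 else t ^ (k - i) / fact (k - i)))
        * ?P (k - 1) $$ (a, l) * e k l"
      unfolding sum_distrib_right by (rule sum.cong[OF refl], subst flow[OF _ k l]) auto
    then show "(\<Sum>i=1..r+1. \<alpha> i
        * (\<Sum>j<m (i - 1). ?P (i - 1) $$ (a, j) * flow_entry m B t i j k l) * e k l)
      = (\<Sum>i=0..k - 1. \<alpha> (k - i) * (t ^ i / fact i)) * ?P (k - 1) $$ (a, l) * e k l"
      unfolding reindex[OF k] .
  qed
  finally show ?thesis unfolding sum_coords .
qed

lemma index_mult_grad:
  assumes "A \<in> carrier_mat n (m (k - 1))" "a < n"
  shows "(A *\<^sub>v grad m k f y) $ a = (\<Sum>l<m (k - 1). A $$ (a, l) * partial_deriv k l f y)"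
  using assms by (auto simp: grad_def scalar_prod_def atLeast0LessThan intro!: sum.cong)

text \<open>
  For \<open>A = \<sigma> \<sigma>\<^sup>T\<close> the quadratic form is \<open>\<bar>\<sigma>\<^sup>T v\<bar>\<^sup>2\<close>. In particular it is nonnegative, so squaring
  undoes the square root.
\<close>
lemma mat_seminorm_square:
  assumes \<sigma>: "\<sigma> \<in> carrier_mat n n" and v: "v \<in> carrier_vec n"
  shows "(mat_seminorm (\<sigma> * transpose_mat \<sigma>) v)\<^sup>2 = (\<Sum>b<n. (\<Sum>a<n. \<sigma> $$ (a, b) * v $ a)\<^sup>2)"
proof -
  have s: "transpose_mat \<sigma> \<in> carrier_mat n n" using \<sigma> by simp
  have u: "transpose_mat \<sigma> *\<^sub>v v \<in> carrier_vec n" using s v by simp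
  have "scalar_prod v ((\<sigma> * transpose_mat \<sigma>) *\<^sub>v v)
      = scalar_prod v (\<sigma> *\<^sub>v (transpose_mat \<sigma> *\<^sub>v v))"
    using \<sigma> s v by (simp add: assoc_mult_mat_vec)
  also have "\<dots> = scalar_prod (transpose_mat \<sigma> *\<^sub>v v) (transpose_mat \<sigma> *\<^sub>v v)"
    by (rule transpose_vec_mult_scalar[OF \<sigma> u v, symmetric])
  also have "\<dots> = (\<Sum>b<n. (\<Sum>a<n. \<sigma> $$ (a, b) * v $ a)\<^sup>2)"
    using \<sigma> v by (auto simp: scalar_prod_def atLeast0LessThan power2_eq_square intro!: sum.cong)
  finally show ?thesis
    by (simp add: mat_seminorm_def sum_nonneg)
qed

lemma square_expectation_le:
  fixes U :: "'w \<Rightarrow> real"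
  assumes "prob_space M" "integrable M U" "integrable M (\<lambda>\<omega>. (U \<omega>)\<^sup>2)"
  shows "(\<integral>\<omega>. U \<omega> \<partial>M)\<^sup>2 \<le> (\<integral>\<omega>. (U \<omega>)\<^sup>2 \<partial>M)"
proof -
  interpret prob_space M by fact
  show ?thesis using variance_eq[OF assms(2,3)] variance_positive[of U] by simp
qed

lemma square_integrable_linear_combination:
  fixes Y :: "'i \<Rightarrow> 'w \<Rightarrow> real"
  assumes "finite I"
    and Y: "\<And>i. i \<in> I \<Longrightarrow> integrable M (Y i)" "\<And>i. i \<in> I \<Longrightarrow> integrable M (\<lambda>\<omega>. (Y i \<omega>)\<^sup>2)"
  shows "integrable M (\<lambda>\<omega>. \<Sum>i\<in>I. b i * Y i \<omega>)"
    and "integrable M (\<lambda>\<omega>. (\<Sum>i\<in>I. b i * Y i \<omega>)\<^sup>2)"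
proof -
  show lin: "integrable M (\<lambda>\<omega>. \<Sum>i\<in>I. b i * Y i \<omega>)"
    using Y(1) by (intro Bochner_Integration.integrable_sum integrable_mult_right)
  show "integrable M (\<lambda>\<omega>. (\<Sum>i\<in>I. b i * Y i \<omega>)\<^sup>2)"
  proof (rule Bochner_Integration.integrable_bound)
    show "integrable M (\<lambda>\<omega>. (\<Sum>i\<in>I. (b i)\<^sup>2) * (\<Sum>i\<in>I. (Y i \<omega>)\<^sup>2))"
      using Y(2) by (intro Bochner_Integration.integrable_sum integrable_mult_right)
    show "(\<lambda>\<omega>. (\<Sum>i\<in>I. b i * Y i \<omega>)\<^sup>2) \<in> borel_measurable M"
      using lin by (intro borel_measurable_power borel_measurable_integrable)
    show "AE \<omega> in M. norm ((\<Sum>i\<in>I. b i * Y i \<omega>)\<^sup>2) \<le> norm ((\<Sum>i\<in>I. (b i)\<^sup>2) * (\<Sum>i\<in>I. (Y i \<omega>)\<^sup>2))"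
      using Cauchy_Schwarz_ineq_sum[of b "\<lambda>i. Y i _" I]
      by (intro AE_I2) (simp add: order_trans[OF _ abs_ge_self])
  qed
qed

theorem proposition2p5:
  fixes r :: nat and m :: "nat \<Rightarrow> nat"
    and \<sigma> A\<^sub>0 :: "real mat" and B :: "nat \<Rightarrow> real mat"
    and M :: "'w measure" and W :: "real \<Rightarrow> 'w \<Rightarrow> nat \<Rightarrow> real"
    and X :: "point \<Rightarrow> real \<Rightarrow> 'w \<Rightarrow> point"
    and f :: "point \<Rightarrow> real"
    and t :: real and x :: point and \<alpha> :: "nat \<Rightarrow> real"
  assumes "r \<ge> 1"
    and "\<And>k. k < r \<Longrightarrow> m (Suc k) \<le> m k" and "m r \<ge> 1"
    and "\<sigma> \<in> carrier_mat (m 0) (m 0)" and "A\<^sub>0 = \<sigma> * transpose_mat \<sigma>"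
    and "\<And>k. k \<in> {1..r} \<Longrightarrow> B k \<in> carrier_mat (m (k - 1)) (m k)"
    and "\<And>k. k \<in> {1..r} \<Longrightarrow> vec_space.rank (m (k - 1)) (B k) = m k"
    and "std_brownian_motion M (m 0) W"
    and "\<And>y. y \<in> state_space r m \<Longrightarrow> solves_sde M r m \<sigma> B W y (X y)"
    and "C_k r m 2 f" and "bounded_second_derivs r m f"
    and "t \<ge> 0" and "x \<in> state_space r m" and "\<alpha> 1 = 1"
  shows "(mat_seminorm A\<^sub>0 (finsum_vec TYPE(real) (m 0)
            (\<lambda>i'. \<alpha> i' \<cdot>\<^sub>v (ordered_prod m B (i' - 1) *\<^sub>v
                   grad m i' (semigroup_of M X t f) x)) {1..r + 1}))\<^sup>2
         \<le> semigroup_of M X t (\<lambda>y. (mat_seminorm A\<^sub>0 (finsum_vec TYPE(real) (m 0)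
            (\<lambda>i'. ((\<Sum>i=0..i' - 1. \<alpha> (i' - i) * (t ^ i / fact i)) \<cdot>\<^sub>m
                   ordered_prod m B (i' - 1)) *\<^sub>v grad m i' f y) {1..r + 1}))\<^sup>2) x"
proof -
  note \<sigma> = assms(4) and B = assms(6) and W = assms(8) and sol = assms(9)
    and C2 = assms(10) and bd = assms(11) and t = assms(12) and x = assms(13)
  have P: "prob_space M" using W by (simp add: std_brownian_motion_def)
  let ?P = "ordered_prod m B" and ?n = "m 0"
  let ?w = "\<lambda>k. \<Sum>i=0..k - 1. \<alpha> (k - i) * (t ^ i / fact i)"
  let ?L = "finsum_vec TYPE(real) ?n (\<lambda>i'. \<alpha> i' \<cdot>\<^sub>v (?P (i' - 1) *\<^sub>v
              grad m i' (semigroup_of M X t f) x)) {1..r + 1}"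
  let ?V = "\<lambda>y. finsum_vec TYPE(real) ?n (\<lambda>i'. (?w i' \<cdot>\<^sub>m ?P (i' - 1)) *\<^sub>v grad m i' f y) {1..r + 1}"
  have Pc: "?P (k - 1) \<in> carrier_mat ?n (m (k - 1))" if "k \<in> {1..r + 1}" for k
    by (rule ordered_prod_carrier[where r = r]) (use B that in auto)
  have Vc: "(\<lambda>i'. (?w i' \<cdot>\<^sub>m ?P (i' - 1)) *\<^sub>v grad m i' f y) \<in> {1..r + 1} \<rightarrow> carrier_vec ?n" for y
    by (intro Pi_I mult_mat_vec_carrier[OF smult_carrier_mat[OF Pc]]) (simp_all add: grad_def)
  have Lc: "(\<lambda>i'. \<alpha> i' \<cdot>\<^sub>v (?P (i' - 1) *\<^sub>v grad m i' (semigroup_of M X t f) x))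
      \<in> {1..r + 1} \<rightarrow> carrier_vec ?n"
    by (intro Pi_I smult_carrier_vec[THEN iffD2] mult_mat_vec_carrier[OF Pc]) (simp_all add: grad_def)
  have V: "?V y $ a = (\<Sum>k=1..r+1. \<Sum>l<m (k - 1). (?w k * ?P (k - 1) $$ (a, l)) * partial_deriv k l f y)"
    if a: "a < ?n" for y a
    unfolding index_finsum_vec[OF finite_atLeastAtMost a Vc]
  proof (rule sum.cong[OF refl])
    fix k assume k: "k \<in> {1..r + 1}"
    show "((?w k \<cdot>\<^sub>m ?P (k - 1)) *\<^sub>v grad m k f y) $ a
        = (\<Sum>l<m (k - 1). (?w k * ?P (k - 1) $$ (a, l)) * partial_deriv k l f y)"
      by (subst index_mult_grad[where m = m and k = k, OF smult_carrier_mat[OF Pc[OF k]] a]) (use Pc[OF k] a in auto)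
  qed
  define E where "E k l = (\<integral>\<omega>. partial_deriv k l f (X x t \<omega>) \<partial>M)" for k l
  have L: "?L $ a = (\<Sum>k=1..r+1. \<Sum>l<m (k - 1). (?w k * ?P (k - 1) $$ (a, l)) * E k l)"
    if a: "a < ?n" for a
  proof -
    have "?L $ a = (\<Sum>i=1..r+1. \<alpha> i * (\<Sum>j<m (i - 1). ?P (i - 1) $$ (a, j)
        * (\<Sum>(k, l)\<in>coords r m. flow_entry m B t i j k l * E k l)))"
      unfolding index_finsum_vec[OF finite_atLeastAtMost a Lc]
    proof (rule sum.cong[OF refl])
      fix i assume i: "i \<in> {1..r + 1}"
      have "(?P (i - 1) *\<^sub>v grad m i (semigroup_of M X t f) x) $ a
          = (\<Sum>j<m (i - 1). ?P (i - 1) $$ (a, j) * partial_deriv i j (semigroup_of M X t f) x)"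
        by (rule index_mult_grad[where m = m and k = i, OF Pc[OF i] a])
      also have "\<dots> = (\<Sum>j<m (i - 1). ?P (i - 1) $$ (a, j)
          * (\<Sum>(k, l)\<in>coords r m. flow_entry m B t i j k l * E k l))"
        unfolding E_def
        by (rule sum.cong[OF refl], subst semigroup_partial_deriv[OF W sol \<sigma> B C2 bd t x])
          (use i in \<open>auto simp: coords_def\<close>)
      finally show "(\<alpha> i \<cdot>\<^sub>v (?P (i - 1) *\<^sub>v grad m i (semigroup_of M X t f) x)) $ a
          = \<alpha> i * (\<Sum>j<m (i - 1). ?P (i - 1) $$ (a, j)
            * (\<Sum>(k, l)\<in>coords r m. flow_entry m B t i j k l * E k l))"
        using Pc[OF i] a by simp
    qed
    also have "\<dots> = (\<Sum>k=1..r+1. \<Sum>l<m (k - 1). (?w k * ?P (k - 1) $$ (a, l)) * E k l)"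
      by (rule collect_gradient_weights) (use B a in auto)
    finally show ?thesis .
  qed
  \<comment> \<open>coefficients of the components of \<open>\<sigma>\<^sup>T v\<close> in terms of the partial derivatives\<close>
  define \<beta> where "\<beta> b = (\<lambda>(k, l). \<Sum>a<?n. \<sigma> $$ (a, b) * (?w k * ?P (k - 1) $$ (a, l)))" for b
  have regroup: "(\<Sum>a<?n. \<sigma> $$ (a, b) * (\<Sum>k=1..r+1. \<Sum>l<m (k - 1). (?w k * ?P (k - 1) $$ (a, l)) * e k l))
      = (\<Sum>c\<in>coords r m. \<beta> b c * e (fst c) (snd c))" for b e
  proof -
    have "(\<Sum>a<?n. \<sigma> $$ (a, b) * (\<Sum>k=1..r+1. \<Sum>l<m (k - 1). (?w k * ?P (k - 1) $$ (a, l)) * e k l))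
        = (\<Sum>a<?n. \<Sum>c\<in>coords r m. \<sigma> $$ (a, b)
            * ((?w (fst c) * ?P (fst c - 1) $$ (a, snd c)) * e (fst c) (snd c)))"
      by (simp only: sum_coords[where r = r and m = m, symmetric] case_prod_beta sum_distrib_left)
    also have "\<dots> = (\<Sum>c\<in>coords r m. \<Sum>a<?n. \<sigma> $$ (a, b)
            * ((?w (fst c) * ?P (fst c - 1) $$ (a, snd c)) * e (fst c) (snd c)))"
      by (rule sum.swap)
    also have "\<dots> = (\<Sum>c\<in>coords r m. \<beta> b c * e (fst c) (snd c))"
      unfolding \<beta>_def case_prod_beta
      by (rule sum.cong[OF refl]) (subst sum_distrib_right, simp only: mult.assoc)
    finally show ?thesis .
  qed
  have L': "(\<Sum>a<?n. \<sigma> $$ (a, b) * ?L $ a) = (\<Sum>c\<in>coords r m. \<beta> b c * E (fst c) (snd c))" for b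
    unfolding regroup[symmetric] by (rule sum.cong[OF refl]) (simp only: L lessThan_iff)
  have V': "(\<Sum>a<?n. \<sigma> $$ (a, b) * ?V y $ a)
      = (\<Sum>c\<in>coords r m. \<beta> b c * partial_deriv (fst c) (snd c) f y)" for b y
    unfolding regroup[where e = "\<lambda>k l. partial_deriv k l f y", symmetric]
    by (rule sum.cong[OF refl]) (simp only: V lessThan_iff)
  define U where "U b \<omega> = (\<Sum>c\<in>coords r m. \<beta> b c * partial_deriv (fst c) (snd c) f (X x t \<omega>))" for b \<omega>
  have dint: "integrable M (\<lambda>\<omega>. partial_deriv k l f (X x t \<omega>))" if "(k, l) \<in> coords r m" for k l
    by (rule solution_partial_deriv_integrable(1)[OF W sol[OF x] \<sigma> B C2 bd t x that])
  have dint2: "integrable M (\<lambda>\<omega>. (partial_deriv k l f (X x t \<omega>))\<^sup>2)"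
    if "(k, l) \<in> coords r m" for k l
    by (rule solution_partial_deriv_integrable(2)[OF W sol[OF x] \<sigma> B C2 bd t x that])
  have U: "integrable M (U b)" "integrable M (\<lambda>\<omega>. (U b \<omega>)\<^sup>2)" for b
    unfolding U_def[abs_def]
    using square_integrable_linear_combination[OF finite_coords,
        of r m M "\<lambda>c \<omega>. partial_deriv (fst c) (snd c) f (X x t \<omega>)"] dint dint2 by auto
  have EU: "(\<integral>\<omega>. U b \<omega> \<partial>M) = (\<Sum>c\<in>coords r m. \<beta> b c * E (fst c) (snd c))" for b
    unfolding U_def E_def
    by (subst Bochner_Integration.integral_sum) (use dint in auto)
  have "(mat_seminorm A\<^sub>0 ?L)\<^sup>2 = (\<Sum>b<?n. (\<integral>\<omega>. U b \<omega> \<partial>M)\<^sup>2)"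
    unfolding assms(5) mat_seminorm_square[OF \<sigma> finsum_vec_closed[OF Lc]] EU
    by (simp only: L')
  also have "\<dots> \<le> (\<Sum>b<?n. \<integral>\<omega>. (U b \<omega>)\<^sup>2 \<partial>M)"
    by (intro sum_mono square_expectation_le P U)
  also have "\<dots> = (\<integral>\<omega>. (\<Sum>b<?n. (U b \<omega>)\<^sup>2) \<partial>M)"
    by (rule Bochner_Integration.integral_sum[symmetric]) (rule U)
  also have "\<dots> = semigroup_of M X t (\<lambda>y. (mat_seminorm A\<^sub>0 (?V y))\<^sup>2) x"
    unfolding semigroup_of_def assms(5) mat_seminorm_square[OF \<sigma> finsum_vec_closed[OF Vc]] U_def
    by (simp only: V')
  finally show ?thesis .
qed

end
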